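(* Let $n$ be an odd natural number, $h_n:=\frac{n-1}{2}$, $1\le\ell\le h_n$, and let $T\in\mathcal{BC}^{0,1}(V_n)$. If $s\in\mathbb{R}^{n+1}$ satisfies $\|T\|<|s|$, then $$\mathcal{Q}_{c,s}^{-\ell}(T)=\sum_{k=2\ell-1}^\infty\mathcal{H}_\ell^k(T)\,s^{-k-1}.$$ Moreover, $s\mapsto\mathcal{Q}_{c,s}^{-\ell}(T)$ is a $\mathcal{B}(V_n)$-valued intrinsic slice hyperholomorphic function (on $\rho_S(T)$).
   Context: $\mathbb{R}_n$ is the real Clifford algebra generated by $e_1,\dots,e_n$, $e_ie_j+e_je_i=-2\delta_{ij}$, with basis $e_A$ ($A\subseteq\{1,\dots,n\}$); $s=(s_0,\dots,s_n)\in\mathbb{R}^{n+1}$ is identified with the paravector $s_0+\sum_{j=1}^ns_je_j$; $\mathbb{S}$ is the set of $\sum_{j=1}^n x_je_j$ with $\sum x_j^2=1$. $V$ is a real Banach space, $V_n=V\otimes\mathbb{R}_n$ with left and right multiplication by $\mathbb{R}_n$. For $T_A\in\mathcal{B}(V)$, $T=\sum_AT_Ae_A$ acts by $T(\sum_Bv_Be_B)=\sum_{A,B}T_A(v_B)e_Ae_B$; the set of these (right linear) operators is $\mathcal{B}(V_n)$, with norm $\|T\|=\sum_A\|T_A\|_{\mathcal{B}(V)}$. A Clifford number acts by left multiplication and products denote composition. $\mathcal{BC}^{0,1}(V_n)$ is the set of $T=T_0+\sum_{\mu=1}^ne_\mu T_\mu$ with $T_\mu\in\mathcal{B}(V)$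 pairwise commuting; $\overline T=T_0-\sum_{\mu=1}^ne_\mu T_\mu$, so $T\overline T=\overline TT=\sum_{\mu=0}^nT_\mu^2$. $\mathcal{Q}_{c,s}(T)=s^2\mathcal{I}-2sT_0+T\overline T$; $\rho_S(T)=\{s\in\mathbb{R}^{n+1}:\mathcal{Q}_{c,s}(T)\text{ is invertible in }\mathcal{B}(V_n)\}$; $\mathcal{Q}_{c,s}^{-\ell}(T)=(\mathcal{Q}_{c,s}(T)^{-1})^\ell$. For $k\ge2\ell-1$, $$\mathcal{H}_\ell^k(T)=\sum_{j=0}^{k-2\ell+1}\binom{\ell+j-1}{\ell-1}\binom{k-\ell-j}{\ell-1}T^{k-2\ell+1-j}\overline T^{\,j}.$$ A function $K$ from an axially symmetric open set $U\subseteq\mathbb{R}^{n+1}$ to $\mathcal{B}(V_n)$ is left (resp. right) slice hyperholomorphic if there are $A,B:\{(u,v)\in\mathbb{R}^2:u+Jv\in U\ \forall J\in\mathbb{S}\}\to\mathcal{B}(V_n)$ with $K(u+Jv)=A(u,v)+JB(u,v)$ (resp. $A(u,v)+B(u,v)J$) for every $J\in\mathbb{S}$, $A(u,-v)=A(u,v)$, $B(u,-v)=-B(u,v)$, and $\partial_uA=\partial_vB$, $\partial_vA=-\partial_uB$ (derivatives in operator norm). It is intrinsic if moreover $A(u,v),B(u,v)$ are two-sided $\mathbb{R}_n$-linear. *)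

theory Defs
  imports "HOL-Analysis.Analysis"
begin

section \<open>Clifford-valued coefficients\<close>

text \<open>
  Fix a finite linearly ordered index type \<open>'n\<close> in the role of \<open>{1,\<dots>,n}\<close>, so \<open>n = CARD('n)\<close>.
  An element of \<open>('a, 'n) cliff\<close> is a formal sum \<open>\<Sum>A. x_A e_A\<close>, i.e. an element of
  \<open>'a \<otimes> \<real>_n\<close>, with \<open>cf x A\<close> the coefficient at \<open>e_A\<close>. Thus \<open>(real, 'n) cliff\<close> is the Clifford
  algebra \<open>\<real>_n\<close> and \<open>('v, 'n) cliff\<close> is \<open>V_n\<close>.
\<close>

typedef ('a, 'n) cliff = "UNIV :: ('n set \<Rightarrow> 'a) set"
  morphisms cf Cliff by simp

lemma cf_Cliff [simp]: "cf (Cliff f) = f"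
  by (simp add: Cliff_inverse)

lemma cliff_eqI: "(\<And>A. cf x A = cf y A) \<Longrightarrow> x = y"
  by (metis cf_inject ext)

instantiation cliff :: (real_vector, type) real_vector
begin
definition "0 = Cliff (\<lambda>_. 0)"
definition "x + y = Cliff (\<lambda>A. cf x A + cf y A)"
definition "- x = Cliff (\<lambda>A. - cf x A)"
definition "x - y = Cliff (\<lambda>A. cf x A - cf y A)"
definition "r *\<^sub>R x = Cliff (\<lambda>A. r *\<^sub>R cf x A)"
instance
  by standard
     (auto intro!: cliff_eqI simp: zero_cliff_def plus_cliff_def uminus_cliff_def minus_cliff_def
       scaleR_cliff_def algebra_simps)
end

lemma cf_simps [simp]:
  "cf 0 A = 0" "cf (x + y) A = cf x A + cf y A" "cf (- x) A = - cf x A"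
  "cf (x - y) A = cf x A - cf y A" "cf (r *\<^sub>R x) A = r *\<^sub>R cf x A"
  by (simp_all add: zero_cliff_def plus_cliff_def uminus_cliff_def minus_cliff_def scaleR_cliff_def)

lemma cf_sum [simp]: "cf (\<Sum>i\<in>I. f i) A = (\<Sum>i\<in>I. cf (f i) A)"
  by (induction I rule: infinite_finite_induct) auto

text \<open>\<open>blade A v\<close> is \<open>v e_A\<close>.\<close>

definition blade :: "'n set \<Rightarrow> 'a \<Rightarrow> ('a::real_vector, 'n) cliff" where
  "blade A v = Cliff (\<lambda>B. if B = A then v else 0)"

lemma cf_blade [simp]: "cf (blade A v) B = (if B = A then v else 0)"
  by (simp add: blade_def)

text \<open>
  \<open>e_A e_B = csign A B e_{A \<triangle> B}\<close>: a factor \<open>-1\<close> for each pair \<open>i > j\<close> that has to be swapped, and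
  one for each \<open>i = j\<close>, because \<open>e_i^2 = -1\<close>.
\<close>

definition csign :: "'n::{finite,linorder} set \<Rightarrow> 'n set \<Rightarrow> real" where
  "csign A B = (\<Prod>i\<in>A. \<Prod>j\<in>B. if j \<le> i then - 1 else 1)"

text \<open>
  The product \<open>(\<Sum>A. x_A e_A) (\<Sum>B. y_B e_B) = \<Sum>A B. f x_A y_B (e_A e_B)\<close>, where \<open>f\<close> is the
  bilinear pairing of the coefficients.
\<close>

definition cprod :: "('a \<Rightarrow> 'b \<Rightarrow> 'c) \<Rightarrow> ('a, 'n::{finite,linorder}) cliff \<Rightarrow> ('b, 'n) cliff
    \<Rightarrow> ('c::real_vector, 'n) cliff" where
  "cprod f x y = (\<Sum>A\<in>UNIV. \<Sum>B\<in>UNIV. blade (sym_diff A B) (csign A B *\<^sub>R f (cf x A) (cf y B)))"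

lemma sym_diff_eq_iff: "C = sym_diff A B \<longleftrightarrow> B = sym_diff A C"
  by blast

lemma sym_diff_cancel [simp]: "sym_diff A (sym_diff A B) = B"
  by blast

lemma cf_cprod:
  fixes x :: "('a, 'n::{finite,linorder}) cliff"
  shows "cf (cprod f x y) C
    = (\<Sum>A\<in>UNIV. csign A (sym_diff A C) *\<^sub>R f (cf x A) (cf y (sym_diff A C)))"
proof -
  have "(C = sym_diff A B) = (B = sym_diff A C)" for A B :: "'n set"
    by (rule sym_diff_eq_iff)
  then show ?thesis
    by (simp add: cprod_def sum.delta)
qed

lemma csign_sq: "csign A B * csign A B = 1"
  unfolding csign_def prod.distrib [symmetric] by (rule prod.neutral, rule ballI, rule prod.neutral) simp

lemma csign_empty [simp]: "csign {} B = 1" "csign A {} = 1"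
  by (simp_all add: csign_def)

lemma csign_sym_diff_left: "csign (sym_diff A B) C = csign A C * csign B C"
proof -
  let ?g = "\<lambda>i. \<Prod>j\<in>C. if j \<le> i then - 1 else (1::real)"
  have sq: "?g i * ?g i = 1" for i
    unfolding prod.distrib [symmetric] by (rule prod.neutral) simp
  have A: "prod ?g A = prod ?g (A - B) * prod ?g (A \<inter> B)"
    using prod.Int_Diff [of A ?g B] by (simp add: mult.commute)
  have B: "prod ?g B = prod ?g (B - A) * prod ?g (A \<inter> B)"
    using prod.Int_Diff [of B ?g A] by (simp add: mult.commute Int_commute)
  have "prod ?g (A \<inter> B) * prod ?g (A \<inter> B) = 1"
    unfolding prod.distrib [of ?g ?g "A \<inter> B", symmetric] by (intro prod.neutral ballI sq)
  moreover have "prod ?g (sym_diff A B) = prod ?g (A - B) * prod ?g (B - A)"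
    by (rule prod.union_disjoint) auto
  ultimately show ?thesis
    unfolding csign_def A B by (simp add: algebra_simps)
qed

lemma csign_sym_diff_right: "csign C (sym_diff A B) = csign C A * csign C B"
proof -
  let ?g = "\<lambda>j. \<Prod>i\<in>C. if j \<le> i then - 1 else (1::real)"
  have sq: "?g i * ?g i = 1" for i
    unfolding prod.distrib [symmetric] by (rule prod.neutral) simp
  have A: "prod ?g A = prod ?g (A - B) * prod ?g (A \<inter> B)"
    using prod.Int_Diff [of A ?g B] by (simp add: mult.commute)
  have B: "prod ?g B = prod ?g (B - A) * prod ?g (A \<inter> B)"
    using prod.Int_Diff [of B ?g A] by (simp add: mult.commute Int_commute)
  have "prod ?g (A \<inter> B) * prod ?g (A \<inter> B) = 1"
    unfolding prod.distrib [of ?g ?g "A \<inter> B", symmetric] by (intro prod.neutral ballI sq)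
  moreover have "prod ?g (sym_diff A B) = prod ?g (A - B) * prod ?g (B - A)"
    by (rule prod.union_disjoint) auto
  ultimately have "prod ?g (sym_diff A B) = prod ?g A * prod ?g B"
    unfolding A B by (simp add: algebra_simps)
  then show ?thesis
    unfolding csign_def prod.swap [of _ _ C] .
qed

lemma cprod_assoc:
  fixes x :: "('a::real_vector, 'n::{finite,linorder}) cliff"
    and y :: "('b::real_vector, 'n) cliff" and z :: "('c::real_vector, 'n) cliff"
    and f :: "'d::real_vector \<Rightarrow> 'c \<Rightarrow> 'e::real_vector" and h :: "'a \<Rightarrow> 'f::real_vector \<Rightarrow> 'e"
  assumes f: "\<And>v. linear (\<lambda>u. f u v)" and h: "\<And>u. linear (h u)"
    and assoc: "\<And>a b c. f (g a b) c = h a (k b c)"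
  shows "cprod f (cprod g x y) z = cprod h x (cprod k y z)"
proof (rule cliff_eqI)
  fix D :: "'n set"
  let ?X = "cf x" and ?Y = "cf y" and ?Z = "cf z"
  have "cf (cprod f (cprod g x y) z) D
      = (\<Sum>E\<in>UNIV. \<Sum>A\<in>UNIV. (csign E (sym_diff E D) * csign A (sym_diff A E)) *\<^sub>R
          f (g (?X A) (?Y (sym_diff A E))) (?Z (sym_diff E D)))"
    by (simp add: cf_cprod linear_sum [OF f] linear_cmul [OF f] scaleR_sum_right)
  also have "\<dots> = (\<Sum>A\<in>UNIV. \<Sum>E\<in>UNIV. (csign E (sym_diff E D) * csign A (sym_diff A E)) *\<^sub>R
          f (g (?X A) (?Y (sym_diff A E))) (?Z (sym_diff E D)))"
    by (rule sum.swap)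
  also have "\<dots> = (\<Sum>A\<in>UNIV. \<Sum>B\<in>UNIV. (csign A (sym_diff A D) * csign B (sym_diff B (sym_diff A D))) *\<^sub>R
          h (?X A) (k (?Y B) (?Z (sym_diff B (sym_diff A D)))))"
  proof (rule sum.cong [OF refl])
    fix A :: "'n set"
    show "(\<Sum>E\<in>UNIV. (csign E (sym_diff E D) * csign A (sym_diff A E)) *\<^sub>R
          f (g (?X A) (?Y (sym_diff A E))) (?Z (sym_diff E D)))
      = (\<Sum>B\<in>UNIV. (csign A (sym_diff A D) * csign B (sym_diff B (sym_diff A D))) *\<^sub>R
          h (?X A) (k (?Y B) (?Z (sym_diff B (sym_diff A D)))))"
    proof (rule sum.reindex_bij_witness [where i = "sym_diff A" and j = "sym_diff A"], goal_cases)
      case (5 E)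
      define B where "B = sym_diff A E"
      define W where "W = sym_diff E D"
      have E: "E = sym_diff A B" unfolding B_def by blast
      have W: "W = sym_diff B (sym_diff A D)" unfolding W_def B_def by blast
      have AD: "sym_diff A D = sym_diff B W" unfolding W_def B_def by blast
      have "csign A (sym_diff A D) * csign B W = csign A B * csign A W * csign B W"
        unfolding AD csign_sym_diff_right ..
      also have "\<dots> = csign E W * csign A B"
        unfolding E csign_sym_diff_left by simp
      finally show ?case
        unfolding B_def [symmetric] W_def [symmetric] W [symmetric] assoc by simp
    qed auto
  qed
  also have "\<dots> = cf (cprod h x (cprod k y z)) D"
    by (simp add: cf_cprod linear_sum [OF h] linear_cmul [OF h] scaleR_sum_right)
  finally show "cf (cprod f (cprod g x y) z) D = cf (cprod h x (cprod k y z)) D" .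
qed

lemma cprod_blade_left:
  assumes "\<And>v. f 0 v = 0"
  shows "cf (cprod f (blade A a) y) C = csign A (sym_diff A C) *\<^sub>R f a (cf y (sym_diff A C))"
proof -
  have "cf (cprod f (blade A a) y) C
    = (\<Sum>B\<in>UNIV. if B = A then csign A (sym_diff A C) *\<^sub>R f a (cf y (sym_diff A C)) else 0)"
    unfolding cf_cprod by (rule sum.cong) (auto simp: assms)
  then show ?thesis by simp
qed

lemma cprod_blade_right:
  assumes "\<And>u. f u 0 = 0"
  shows "cf (cprod f x (blade B b)) C = csign (sym_diff B C) B *\<^sub>R f (cf x (sym_diff B C)) b"
proof -
  have eq: "sym_diff A C = B \<longleftrightarrow> A = sym_diff B C" for A by blast
  have "cf (cprod f x (blade B b)) C
    = (\<Sum>A\<in>UNIV. if A = sym_diff B C then csign (sym_diff B C) B *\<^sub>R f (cf x (sym_diff B C)) b else 0)"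
    unfolding cf_cprod
  proof (rule sum.cong [OF refl])
    fix A
    have "A = sym_diff B C \<Longrightarrow> sym_diff A C = B" by blast
    then show "csign A (sym_diff A C) *\<^sub>R f (cf x A) (cf (blade B b) (sym_diff A C))
      = (if A = sym_diff B C then csign (sym_diff B C) B *\<^sub>R f (cf x (sym_diff B C)) b else 0)"
      using eq [of A] by (simp only: cf_blade) (auto simp: assms)
  qed
  then show ?thesis by simp
qed


section \<open>The Clifford algebra\<close>

instantiation cliff :: (real_algebra_1, "{finite,linorder}") real_algebra_1
begin
definition "1 = blade {} (1::'a)"
definition "x * y = cprod (*) x y"
instance
proof
  fix a b c :: "('a, 'b) cliff" and r :: real
  show "a * b * c = a * (b * c)"
    unfolding times_cliff_def
    by (rule cprod_assoc)
       (auto intro!: linearI simp: algebra_simps)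
  show "1 * a = a"
    by (rule cliff_eqI) (simp add: one_cliff_def times_cliff_def cprod_blade_left)
  show "a * 1 = a"
    by (rule cliff_eqI) (simp add: one_cliff_def times_cliff_def cprod_blade_right)
  show "(a + b) * c = a * c + b * c"
    by (rule cliff_eqI) (simp add: times_cliff_def cf_cprod algebra_simps sum.distrib)
  show "a * (b + c) = a * b + a * c"
    by (rule cliff_eqI) (simp add: times_cliff_def cf_cprod algebra_simps sum.distrib)
  show "(r *\<^sub>R a) * b = r *\<^sub>R (a * b)"
    by (rule cliff_eqI) (simp add: times_cliff_def cf_cprod scaleR_sum_right mult.commute)
  show "a * (r *\<^sub>R b) = r *\<^sub>R (a * b)"
    by (rule cliff_eqI) (simp add: times_cliff_def cf_cprod scaleR_sum_right mult.commute)
  show "(0 :: ('a, 'b) cliff) \<noteq> 1"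
  proof
    assume "(0 :: ('a, 'b) cliff) = 1"
    then have "cf (0 :: ('a, 'b) cliff) {} = cf (1 :: ('a, 'b) cliff) {}" by simp
    then show False by (simp add: one_cliff_def)
  qed
qed
end

lemma blade_times:
  "blade A a * blade B b = blade (sym_diff A B) (csign A B *\<^sub>R (a * b))"
proof (rule cliff_eqI)
  fix C
  show "cf (blade A a * blade B b) C = cf (blade (sym_diff A B) (csign A B *\<^sub>R (a * b))) C"
  proof (cases "C = sym_diff A B")
    case True
    then have "sym_diff A C = B" by (simp only: sym_diff_cancel)
    then show ?thesis
      unfolding times_cliff_def by (simp only: cprod_blade_left mult_zero_left cf_blade True if_True simp_thms)
  next
    case False
    then have "sym_diff A C \<noteq> B" by (metis sym_diff_cancel)
    then show ?thesis
      unfolding times_cliff_def using False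
      by (simp only: cprod_blade_left mult_zero_left cf_blade if_False mult_zero_right scaleR_zero_right simp_thms)
  qed
qed

definition gen :: "'n \<Rightarrow> (real, 'n::{finite,linorder}) cliff" where
  "gen i = blade {i} 1"

lemma gen_anticommute:
  "gen i * gen j + gen j * gen i = (if i = j then - 2 else 0)"
proof (cases "i = j")
  case True
  have "gen i * gen i = blade {} (- 1)"
    by (simp add: gen_def blade_times csign_def)
  also have "\<dots> = - 1"
    by (rule cliff_eqI) (simp add: one_cliff_def)
  finally show ?thesis using True by simp
next
  case False
  then have "csign {i} {j} = - csign {j} {i}"
    by (auto simp: csign_def)
  moreover have "sym_diff {i} {j} = {i, j}" "sym_diff {j} {i} = {i, j}"
    using False by auto
  ultimately show ?thesis
    unfolding gen_def blade_times using False by (intro cliff_eqI) simp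
qed

lemma blade_insert:
  assumes "\<And>j. j \<in> A \<Longrightarrow> i < j"
  shows "blade (insert i A) (1::real) = gen i * blade A 1"
proof -
  have "i \<notin> A" using assms by blast
  then have "sym_diff {i} A = insert i A" by blast
  moreover have "csign {i} A = 1"
    unfolding csign_def by (intro prod.neutral ballI) (auto dest: assms)
  ultimately show ?thesis
    unfolding gen_def blade_times by simp
qed

text \<open>
  A point \<open>(s_0, \<dots>, s_n)\<close> of \<open>\<real>^{n+1}\<close> is a pair \<open>(s_0, (s_1, \<dots>, s_n))\<close>; the product norm is the
  Euclidean norm. The sphere of unit imaginary vectors \<open>J\<close> is \<open>sphere 0 1\<close> in \<open>real ^ 'n\<close>.
\<close>

definition imvec :: "(real ^ 'n::{finite,linorder}) \<Rightarrow> (real, 'n) cliff" where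
  "imvec x = (\<Sum>j\<in>UNIV. (x $ j) *\<^sub>R gen j)"

definition paravec :: "real \<times> (real ^ 'n::{finite,linorder}) \<Rightarrow> (real, 'n) cliff" where
  "paravec s = of_real (fst s) + imvec (snd s)"

definition has_inv :: "'a::monoid_mult \<Rightarrow> bool" where
  "has_inv x \<longleftrightarrow> (\<exists>y. x * y = 1 \<and> y * x = 1)"

definition inv_el :: "'a::monoid_mult \<Rightarrow> 'a" where
  "inv_el x = (THE y. x * y = 1 \<and> y * x = 1)"

lemma inv_el_unique:
  assumes "x * y = 1" "y * x = 1"
  shows "inv_el x = y"
  unfolding inv_el_def
proof (rule the_equality)
  fix z assume z: "x * z = 1 \<and> z * x = 1"
  have "z = z * (x * y)" using assms by simp
  also have "\<dots> = y" using z by (simp add: mult.assoc [symmetric])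
  finally show "z = y" .
qed (simp add: assms)


section \<open>The two-sided module and its operators\<close>

definition lmul :: "(real, 'n::{finite,linorder}) cliff \<Rightarrow> ('v::real_vector, 'n) cliff \<Rightarrow> ('v, 'n) cliff"
  where "lmul a x = cprod (*\<^sub>R) a x"

definition rmul :: "('v::real_vector, 'n) cliff \<Rightarrow> (real, 'n::{finite,linorder}) cliff \<Rightarrow> ('v, 'n) cliff"
  where "rmul x a = cprod (\<lambda>v r. r *\<^sub>R v) x a"

text \<open>The action of \<open>\<Sum>A. T_A e_A\<close>, with \<open>T_A\<close> a bounded operator on \<open>V\<close>.\<close>

definition act :: "('v::real_normed_vector \<Rightarrow>\<^sub>L 'v, 'n::{finite,linorder}) cliff
    \<Rightarrow> ('v, 'n) cliff \<Rightarrow> ('v, 'n) cliff" where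
  "act T x = cprod blinfun_apply T x"

lemma act_inject: "act T = act S \<longleftrightarrow> T = S"
proof
  assume eq: "act T = act S"
  show "T = S"
  proof (rule cliff_eqI, rule blinfun_eqI)
    fix A v
    have "cf (act U (blade {} v)) A = blinfun_apply (cf U A) v"
      for U :: "('a \<Rightarrow>\<^sub>L 'a, 'b) cliff"
      by (simp add: act_def cprod_blade_right blinfun.zero_right)
    then show "blinfun_apply (cf T A) v = blinfun_apply (cf S A) v"
      using eq by metis
  qed
qed simp

lemma act_zero: "act 0 x = 0"
  and act_add: "act (S + T) x = act S x + act T x"
  and act_minus: "act (- T) x = - act T x"
  and act_diff: "act (S - T) x = act S x - act T x"
  and act_scaleR: "act (r *\<^sub>R T) x = r *\<^sub>R act T x"
  by (rule cliff_eqI; simp add: act_def cf_cprod blinfun.bilinear_simps algebra_simps sum.distrib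
      sum_subtractf sum_negf scaleR_sum_right)+

lemma act_compose: "act (cprod (o\<^sub>L) S T) x = act S (act T x)"
  unfolding act_def
  by (rule cprod_assoc) (auto intro!: linearI simp: blinfun.bilinear_simps)

lemma act_blade_id: "act (blade {} id_blinfun) x = x"
  by (rule cliff_eqI) (simp add: act_def cprod_blade_left)

lemma lmul_eq_act: "lmul a x = act (Cliff (\<lambda>A. cf a A *\<^sub>R id_blinfun)) x"
  by (rule cliff_eqI) (simp add: act_def lmul_def cf_cprod blinfun.bilinear_simps)

lemma act_rmul: "act T (rmul x a) = rmul (act T x) a"
  unfolding act_def rmul_def
  by (rule cprod_assoc [symmetric]) (auto intro!: linearI simp: blinfun.bilinear_simps algebra_simps)

text \<open>\<open>('v, 'n) clop\<close> is \<open>\<B>(V_n)\<close>, as a set of maps on \<open>V_n\<close>, with composition as product.\<close>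

typedef (overloaded) ('v, 'n) clop =
  "range (act :: ('v::real_normed_vector \<Rightarrow>\<^sub>L 'v, 'n::{finite,linorder}) cliff
      \<Rightarrow> ('v, 'n) cliff \<Rightarrow> ('v, 'n) cliff)"
  morphisms app Clop by blast

definition clop_of :: "('v::real_normed_vector \<Rightarrow>\<^sub>L 'v, 'n::{finite,linorder}) cliff \<Rightarrow> ('v, 'n) clop"
  where "clop_of T = Clop (act T)"

text \<open>The components \<open>T_A\<close> of an operator; they are unique by \<open>act_inject\<close>.\<close>

definition comps :: "('v::real_normed_vector, 'n::{finite,linorder}) clop \<Rightarrow> ('v \<Rightarrow>\<^sub>L 'v, 'n) cliff"
  where "comps F = (THE T. app F = act T)"

lemma app_clop_of [simp]: "app (clop_of T) = act T"
  by (simp add: clop_of_def Clop_inverse)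

lemma comps_clop_of [simp]: "comps (clop_of T) = T"
  by (simp add: comps_def act_inject)

lemma comps_Clop_act [simp]: "comps (Clop (act T)) = T"
  using comps_clop_of [of T] by (simp only: clop_of_def)

lemma clop_of_comps [simp]: "clop_of (comps F) = F"
proof -
  obtain T where "app F = act T" using app [of F] by blast
  then have "F = clop_of T" by (metis app_clop_of app_inject)
  then show ?thesis by simp
qed

lemma app_eq_act: "app F = act (comps F)"
  by (metis app_clop_of clop_of_comps)

lemma comps_inject: "comps F = comps G \<longleftrightarrow> F = G"
  by (metis clop_of_comps)

lemma clop_eqI: "(\<And>x. app F x = app G x) \<Longrightarrow> F = G"
  by (metis app_inject ext)

instantiation clop :: (real_normed_vector, "{finite,linorder}") real_normed_vector
begin
definition "0 = Clop (\<lambda>_. 0)"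
definition "F + G = Clop (\<lambda>x. app F x + app G x)"
definition "- F = Clop (\<lambda>x. - app F x)"
definition "F - G = Clop (\<lambda>x. app F x - app G x)"
definition "r *\<^sub>R F = Clop (\<lambda>x. r *\<^sub>R app F x)"
definition "norm F = (\<Sum>A\<in>UNIV. norm (cf (comps F) A))"
definition "sgn F = inverse (norm F) *\<^sub>R F" for F :: "('a, 'b) clop"
definition "dist F G = norm (F - G)" for F :: "('a, 'b) clop"
definition "uniformity = (INF e\<in>{0<..}. principal {(F :: ('a, 'b) clop, G). dist F G < e})"
definition "open S \<longleftrightarrow> (\<forall>F\<in>S. \<forall>\<^sub>F (F', G) in uniformity. F' = F \<longrightarrow> G \<in> S)"
  for S :: "('a, 'b) clop set"
instance
proof -
  have zero: "(0 :: ('a, 'b) clop) = clop_of 0"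
    unfolding zero_clop_def clop_of_def by (rule arg_cong [where f = Clop]) (simp add: fun_eq_iff act_zero)
  have plus: "F + G = clop_of (comps F + comps G)" for F G :: "('a, 'b) clop"
    by (simp add: plus_clop_def clop_of_def app_eq_act act_add [symmetric])
  have um: "- F = clop_of (- comps F)" for F :: "('a, 'b) clop"
    by (simp add: uminus_clop_def clop_of_def app_eq_act act_minus [symmetric])
  have minus: "F - G = clop_of (comps F - comps G)" for F G :: "('a, 'b) clop"
    by (simp add: minus_clop_def clop_of_def app_eq_act act_diff [symmetric])
  have scale: "r *\<^sub>R F = clop_of (r *\<^sub>R comps F)" for r and F :: "('a, 'b) clop"
    by (simp add: scaleR_clop_def clop_of_def app_eq_act act_scaleR [symmetric])
  note defs = zero plus um minus scale
  show "OFCLASS(('a, 'b) clop, real_normed_vector_class)"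
  proof
    fix F G H :: "('a, 'b) clop" and r t :: real
    show "F + G + H = F + (G + H)" "F + G = G + F" "0 + F = F" "- F + F = 0" "F - G = F + - G"
      "r *\<^sub>R (F + G) = r *\<^sub>R F + r *\<^sub>R G" "(r + t) *\<^sub>R F = r *\<^sub>R F + t *\<^sub>R F"
      "r *\<^sub>R t *\<^sub>R F = (r * t) *\<^sub>R F" "1 *\<^sub>R F = F"
      by (simp_all add: defs algebra_simps)
    show "dist F G = norm (F - G)" "sgn F = inverse (norm F) *\<^sub>R F"
      by (simp_all add: dist_clop_def sgn_clop_def)
    show "norm F = 0 \<longleftrightarrow> F = 0"
      unfolding comps_inject [symmetric, of F]
      by (auto simp: norm_clop_def zero sum_nonneg_eq_0_iff intro: cliff_eqI)
    show "norm (F + G) \<le> norm F + norm G"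
      unfolding norm_clop_def plus
      by (simp add: sum.distrib [symmetric] sum_mono norm_triangle_ineq)
    show "norm (r *\<^sub>R F) = \<bar>r\<bar> * norm F"
      by (simp add: norm_clop_def scale sum_distrib_left)
  qed (simp_all add: uniformity_clop_def open_clop_def)
qed
end

lemma app_zero [simp]: "app 0 x = 0"
proof -
  have "(\<lambda>_. 0) = act (0 :: ('a \<Rightarrow>\<^sub>L 'a, 'b) cliff)" by (simp add: fun_eq_iff act_zero)
  then show ?thesis by (simp only: zero_clop_def app_eq_act comps_Clop_act act_zero)
qed

lemma app_add [simp]: "app (F + G) x = app F x + app G x"
  by (simp add: plus_clop_def app_eq_act act_add [symmetric])

lemma app_uminus [simp]: "app (- F) x = - app F x"
  by (simp add: uminus_clop_def app_eq_act act_minus [symmetric])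

lemma app_diff [simp]: "app (F - G) x = app F x - app G x"
  by (simp add: minus_clop_def app_eq_act act_diff [symmetric])

lemma app_scaleR [simp]: "app (r *\<^sub>R F) x = r *\<^sub>R app F x"
  by (simp add: scaleR_clop_def app_eq_act act_scaleR [symmetric])

instantiation clop :: (real_normed_vector, "{finite,linorder}") monoid_mult
begin
definition "1 = Clop (\<lambda>x. x)"
definition "F * G = Clop (\<lambda>x. app F (app G x))"
instance
proof -
  have one: "app (1 :: ('a, 'b) clop) x = x" for x
  proof -
    have "(\<lambda>x. x) = act (blade {} id_blinfun :: ('a \<Rightarrow>\<^sub>L 'a, 'b) cliff)"
      by (simp add: fun_eq_iff act_blade_id)
    then show ?thesis by (simp only: one_clop_def app_eq_act comps_Clop_act act_blade_id)
  qed
  have times: "app (F * G) x = app F (app G x)" for F G :: "('a, 'b) clop" and x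
    by (simp add: times_clop_def app_eq_act act_compose [symmetric])
  show "OFCLASS(('a, 'b) clop, monoid_mult_class)"
    by standard (auto intro!: clop_eqI simp: one times)
qed
end

lemma app_one [simp]: "app 1 x = x"
proof -
  have "(\<lambda>x. x) = act (blade {} id_blinfun :: ('a \<Rightarrow>\<^sub>L 'a, 'b) cliff)"
    by (simp add: fun_eq_iff act_blade_id)
  then show ?thesis by (simp only: one_clop_def app_eq_act comps_Clop_act act_blade_id)
qed

lemma app_times [simp]: "app (F * G) x = app F (app G x)"
  by (simp add: times_clop_def app_eq_act act_compose [symmetric])

text \<open>A Clifford number, and a bounded operator on \<open>V\<close> (acting componentwise), as elements of \<open>\<B>(V_n)\<close>.\<close>

definition cnum :: "(real, 'n::{finite,linorder}) cliff \<Rightarrow> ('v::real_normed_vector, 'n) clop" where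
  "cnum a = Clop (lmul a)"

definition cemb :: "('v::real_normed_vector \<Rightarrow>\<^sub>L 'v) \<Rightarrow> ('v, 'n::{finite,linorder}) clop" where
  "cemb S = clop_of (blade {} S)"

lemma app_cnum [simp]: "app (cnum a) x = lmul a x"
  unfolding cnum_def by (subst Clop_inverse) (auto simp: fun_eq_iff lmul_eq_act)

lemma app_cemb: "app (cemb S) x = Cliff (\<lambda>A. blinfun_apply S (cf x A))"
  by (rule cliff_eqI) (simp add: cemb_def act_def cprod_blade_left blinfun.zero_left)


section \<open>Paravector operators with commuting components\<close>

text \<open>\<open>T_0\<close> and \<open>T_\<mu>\<close>, \<open>\<mu> = 1, \<dots>, n\<close>.\<close>

definition scalar_part :: "('v::real_normed_vector, 'n::{finite,linorder}) clop \<Rightarrow> 'v \<Rightarrow>\<^sub>L 'v" where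
  "scalar_part T = cf (comps T) {}"

definition vector_part :: "('v::real_normed_vector, 'n::{finite,linorder}) clop \<Rightarrow> 'n \<Rightarrow> 'v \<Rightarrow>\<^sub>L 'v" where
  "vector_part T \<mu> = cf (comps T) {\<mu>}"

definition pvop :: "('v::real_normed_vector \<Rightarrow>\<^sub>L 'v) \<Rightarrow> ('n::{finite,linorder} \<Rightarrow> 'v \<Rightarrow>\<^sub>L 'v)
    \<Rightarrow> ('v, 'n) clop" where
  "pvop S0 S = cemb S0 + (\<Sum>\<mu>\<in>UNIV. cnum (gen \<mu>) * cemb (S \<mu>))"

definition BC01 :: "('v::real_normed_vector, 'n::{finite,linorder}) clop set" where
  "BC01 = {pvop S0 S | S0 S. (\<forall>\<mu>. S0 o\<^sub>L S \<mu> = S \<mu> o\<^sub>L S0) \<and> (\<forall>\<mu> \<nu>. S \<mu> o\<^sub>L S \<nu> = S \<nu> o\<^sub>L S \<mu>)}"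

lemma comps_pvop: "comps (pvop S0 S) = blade {} S0 + (\<Sum>\<mu>\<in>UNIV. blade {\<mu>} (S \<mu>))"
proof -
  have plus: "comps (F + G) = comps F + comps G" for F G :: "('a, 'b) clop"
    by (simp add: plus_clop_def app_eq_act act_add [symmetric])
  have zero: "comps (0 :: ('a, 'b) clop) = 0"
    by (metis act_zero app_zero clop_eqI app_clop_of comps_clop_of)
  have sum: "comps (\<Sum>i\<in>I. F i) = (\<Sum>i\<in>I. comps (F i))" for I :: "'b set" and F :: "'b \<Rightarrow> ('a, 'b) clop"
    by (induction I rule: infinite_finite_induct) (auto simp: plus zero)
  have "cnum (gen \<mu>) * cemb R = clop_of (blade {\<mu>} R)" for \<mu> :: 'b and R :: "'a \<Rightarrow>\<^sub>L 'a"
    by (rule clop_eqI, rule cliff_eqI)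
       (simp add: app_cemb gen_def lmul_def act_def cprod_blade_left blinfun.zero_left)
  then show ?thesis
    by (simp add: pvop_def plus sum) (simp add: cemb_def)
qed

lemma scalar_part_pvop [simp]: "scalar_part (pvop S0 S) = S0"
  and vector_part_pvop [simp]: "vector_part (pvop S0 S) \<mu> = S \<mu>"
  by (simp_all add: scalar_part_def vector_part_def comps_pvop)

definition cconj :: "('v::real_normed_vector, 'n::{finite,linorder}) clop \<Rightarrow> ('v, 'n) clop" where
  "cconj T = cemb (scalar_part T) - (\<Sum>\<mu>\<in>UNIV. cnum (gen \<mu>) * cemb (vector_part T \<mu>))"

definition Qc :: "real \<times> (real ^ 'n::{finite,linorder}) \<Rightarrow> ('v::real_normed_vector, 'n) clop
    \<Rightarrow> ('v, 'n) clop" where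
  "Qc s T = cnum (paravec s ^ 2) - 2 *\<^sub>R (cnum (paravec s) * cemb (scalar_part T)) + T * cconj T"

definition rho_S :: "('v::real_normed_vector, 'n::{finite,linorder}) clop \<Rightarrow> (real \<times> (real ^ 'n::{finite,linorder})) set" where
  "rho_S T = {s. has_inv (Qc s T)}"

text \<open>Only meant for \<open>2 l - 1 \<le> k\<close>; then no subtraction below is truncated.\<close>

definition Hpoly :: "nat \<Rightarrow> nat \<Rightarrow> ('v::real_normed_vector, 'n::{finite,linorder}) clop \<Rightarrow> ('v, 'n) clop" where
  "Hpoly l k T = (\<Sum>j = 0..k + 1 - 2 * l.
     (real ((l + j - 1) choose (l - 1)) * real ((k - l - j) choose (l - 1))) *\<^sub>R
       (T ^ (k + 1 - 2 * l - j) * cconj T ^ j))"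


section \<open>Slice hyperholomorphic functions\<close>

definition axially_symmetric :: "(real \<times> (real ^ 'n)) set \<Rightarrow> bool" where
  "axially_symmetric U \<longleftrightarrow> (\<forall>(u, x)\<in>U. \<forall>J\<in>sphere 0 1. (u, norm x *\<^sub>R J) \<in> U)"

definition slice_dom :: "(real \<times> (real ^ 'n)) set \<Rightarrow> (real \<times> real) set" where
  "slice_dom U = {(u, v). \<forall>J\<in>sphere 0 1. (u, v *\<^sub>R J) \<in> U}"

text \<open>
  The conditions on the pair \<open>(A, B)\<close> that do not involve \<open>K\<close>: parity and the Cauchy-Riemann
  equations; \<open>P\<close> and \<open>Q\<close> are the values \<open>\<partial>\<^sub>u A = \<partial>\<^sub>v B\<close> and \<open>\<partial>\<^sub>v A = - \<partial>\<^sub>u B\<close>.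
\<close>

definition slice_pair :: "(real \<times> (real ^ 'n::{finite,linorder})) set
    \<Rightarrow> (real \<Rightarrow> real \<Rightarrow> ('v::real_normed_vector, 'n) clop)
    \<Rightarrow> (real \<Rightarrow> real \<Rightarrow> ('v, 'n) clop) \<Rightarrow> bool" where
  "slice_pair U A B \<longleftrightarrow>
     (\<forall>(u, v)\<in>slice_dom U. A u (- v) = A u v \<and> B u (- v) = - B u v \<and>
        (\<exists>P Q. ((\<lambda>x. A x v) has_vector_derivative P) (at u) \<and>
               ((\<lambda>y. B u y) has_vector_derivative P) (at v) \<and>
               ((\<lambda>y. A u y) has_vector_derivative Q) (at v) \<and>
               ((\<lambda>x. B x v) has_vector_derivative (- Q)) (at u)))"

definition left_slice_rep :: "(real \<times> (real ^ 'n::{finite,linorder})) set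
    \<Rightarrow> (real \<times> (real ^ 'n::{finite,linorder}) \<Rightarrow> ('v::real_normed_vector, 'n) clop)
    \<Rightarrow> (real \<Rightarrow> real \<Rightarrow> ('v, 'n) clop) \<Rightarrow> (real \<Rightarrow> real \<Rightarrow> ('v, 'n) clop) \<Rightarrow> bool" where
  "left_slice_rep U K A B \<longleftrightarrow> open U \<and> axially_symmetric U \<and> slice_pair U A B \<and>
     (\<forall>(u, v)\<in>slice_dom U. \<forall>J\<in>sphere 0 1. K (u, v *\<^sub>R J) = A u v + cnum (imvec J) * B u v)"

definition right_slice_rep :: "(real \<times> (real ^ 'n::{finite,linorder})) set
    \<Rightarrow> (real \<times> (real ^ 'n::{finite,linorder}) \<Rightarrow> ('v::real_normed_vector, 'n) clop)
    \<Rightarrow> (real \<Rightarrow> real \<Rightarrow> ('v, 'n) clop) \<Rightarrow> (real \<Rightarrow> real \<Rightarrow> ('v, 'n) clop) \<Rightarrow> bool" where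
  "right_slice_rep U K A B \<longleftrightarrow> open U \<and> axially_symmetric U \<and> slice_pair U A B \<and>
     (\<forall>(u, v)\<in>slice_dom U. \<forall>J\<in>sphere 0 1. K (u, v *\<^sub>R J) = A u v + B u v * cnum (imvec J))"

definition two_sided_linear :: "('v::real_normed_vector, 'n::{finite,linorder}) clop \<Rightarrow> bool" where
  "two_sided_linear F \<longleftrightarrow> (\<forall>a x. app F (lmul a x) = lmul a (app F x) \<and> app F (rmul x a) = rmul (app F x) a)"

text \<open>
  A function is intrinsic when it is slice hyperholomorphic with two-sided linear \<open>A\<close> and \<open>B\<close>. For
  such \<open>A, B\<close> the left and the right representation coincide; both are demanded here.
\<close>

definition intrinsic_slice_hyperholomorphic :: "(real \<times> (real ^ 'n::{finite,linorder})) set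
    \<Rightarrow> (real \<times> (real ^ 'n::{finite,linorder}) \<Rightarrow> ('v::real_normed_vector, 'n) clop) \<Rightarrow> bool" where
  "intrinsic_slice_hyperholomorphic U K \<longleftrightarrow>
     (\<exists>A B. left_slice_rep U K A B \<and> right_slice_rep U K A B \<and>
        (\<forall>(u, v)\<in>slice_dom U. two_sided_linear (A u v) \<and> two_sided_linear (B u v)))"

end

theory Submission
  imports Defs
begin

text \<open>
  Since \<open>T + cconj T\<close> and \<open>T * cconj T\<close> have no imaginary part, the polynomials \<open>H\<close> commute with
  Clifford numbers and are the Taylor coefficients of
  \<open>((1 - t T) (1 - t (cconj T))) ^ (- l)\<close>. The three-term recursion for these coefficients says
  that multiplication by \<open>Qc s T\<close> carries the series for \<open>l + 1\<close> to the series for \<open>l\<close>; the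
  series for \<open>l = 0\<close> is \<open>1\<close>.

  For \<open>s = u + J v\<close> one has \<open>Qc s T = a + J b\<close> with two-sided linear commuting \<open>a\<close>, \<open>b\<close>, so the
  inverse is \<open>(a - J b) (a\<^sup>2 + b\<^sup>2)\<^sup>-\<^sup>1\<close>, which exhibits the slice form. The Cauchy-Riemann equations
  hold because inversion and products preserve \<open>\<partial>\<^sub>v = J \<partial>\<^sub>u\<close> on a slice.
\<close>

section \<open>Invertibility in Banach algebras\<close>

lemma inv_el_right_left:
  assumes "has_inv x"
  shows "x * inv_el x = 1" "inv_el x * x = 1"
  using assms inv_el_unique unfolding has_inv_def by metis+

lemma has_invI: "x * y = 1 \<Longrightarrow> y * x = 1 \<Longrightarrow> has_inv x"
  unfolding has_inv_def by blast

lemma inv_el_eq_right_inverse: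
  assumes "has_inv x" "x * y = 1"
  shows "inv_el x = y"
  by (metis assms inv_el_right_left(2) mult.assoc mult_1_left mult_1_right)

lemma has_inv_mult:
  assumes "has_inv x" "has_inv y"
  shows "has_inv (x * y)"
proof (rule has_invI)
  show "x * y * (inv_el y * inv_el x) = 1"
    by (metis assms inv_el_right_left(1) mult.assoc mult_1_left)
  show "inv_el y * inv_el x * (x * y) = 1"
    by (metis assms inv_el_right_left(2) mult.assoc mult_1_left)
qed

lemma inv_el_commute:
  assumes "has_inv x" "x * z = z * x"
  shows "inv_el x * z = z * inv_el x"
  by (metis assms inv_el_right_left mult.assoc mult_1_left mult_1_right)

lemma power_commute:
  fixes x y :: "'a::monoid_mult"
  assumes "x * y = y * x"
  shows "x ^ n * y = y * x ^ n"
proof (induction n)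
  case (Suc n)
  then show ?case by (metis assms mult.assoc power_Suc)
qed simp

text \<open>In the degenerate algebra \<open>1 = 0\<close> has norm \<open>0\<close>, so the class \<open>real_normed_algebra_1\<close> is
  not available.\<close>

lemma norm_power_Suc_le:
  fixes x :: "'a::{real_normed_algebra, monoid_mult}"
  shows "norm (x ^ Suc n) \<le> norm x ^ Suc n"
proof (induction n)
  case (Suc n)
  have "norm (x ^ Suc (Suc n)) \<le> norm x * norm (x ^ Suc n)"
    unfolding power_Suc [of x "Suc n"] by (rule norm_mult_ineq)
  also have "\<dots> \<le> norm x * norm x ^ Suc n"
    by (intro mult_left_mono Suc.IH norm_ge_zero)
  finally show ?case by simp
qed simp

lemma has_inv_one_minus:
  fixes x :: "'a::{real_normed_algebra, banach, monoid_mult}"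
  assumes "norm x < 1"
  shows "has_inv (1 - x)"
proof -
  \<comment> \<open>Neumann series. The comparison starts at the first power, because the bound on
    powers does not cover \<open>x ^ 0\<close>; \<open>x * S\<close> and \<open>S * x\<close> then
    both equal \<open>S - 1\<close>.\<close>
  have "summable (\<lambda>n. norm x ^ Suc n)"
    using assms by (simp add: summable_mult summable_geometric)
  then have "summable (\<lambda>n. x ^ Suc n)"
    by (rule summable_comparison_test' [where N = 0]) (rule norm_power_Suc_le)
  then have summ: "summable (\<lambda>n. x ^ n)"
    by (simp only: summable_Suc_iff)
  define S where "S = (\<Sum>n. x ^ n)"
  have S: "S = 1 + (\<Sum>n. x ^ Suc n)"
    unfolding S_def using suminf_split_head [OF summ] by simp
  have "x * S = (\<Sum>n. x ^ Suc n)"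
    unfolding S_def using suminf_mult [OF summ, of x] by simp
  moreover have "S * x = (\<Sum>n. x ^ Suc n)"
    unfolding S_def using suminf_mult2 [OF summ, of x] by (simp add: power_commutes)
  ultimately show ?thesis
    using S by (intro has_invI [where y = S]) (auto simp: algebra_simps)
qed

section \<open>Openness of the invertible elements and the derivative of inversion\<close>

lemma has_inv_nearby:
  fixes a :: "'a::{real_normed_algebra, banach, monoid_mult}"
  assumes a: "has_inv a" and b: "norm (inv_el a) * norm (b - a) < 1"
  shows "has_inv b"
proof -
  have "norm (inv_el a * (a - b)) < 1"
    using norm_mult_ineq [of "inv_el a" "a - b"] b by (simp add: norm_minus_commute)
  \<comment> \<open>This product is \<open>b\<close>, so the claim reduces to the Neumann series at
    \<open>inv_el a * (a - b)\<close>.\<close>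
  then have "has_inv (a * (1 - inv_el a * (a - b)))"
    by (intro has_inv_mult a has_inv_one_minus)
  moreover have "a * (1 - inv_el a * (a - b)) = b"
    using inv_el_right_left(1) [OF a]
    by (simp add: right_diff_distrib mult.assoc [symmetric])
  ultimately show ?thesis by simp
qed

lemma open_has_inv: "open {a :: 'a::{real_normed_algebra, banach, monoid_mult}. has_inv a}"
proof (rule openI)
  fix a :: 'a
  assume "a \<in> {a. has_inv a}"
  then have a: "has_inv a" by simp
  \<comment> \<open>The summand \<open>1\<close> keeps the denominator positive even when
    \<open>inv_el a = 0\<close>, as happens in the degenerate algebra.\<close>
  define e where "e = 1 / (norm (inv_el a) + 1)"
  have pos: "norm (inv_el a) + 1 > 0" by (simp add: add_nonneg_pos)
  have "ball a e \<subseteq> {a. has_inv a}"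
  proof clarify
    fix b assume "b \<in> ball a e"
    then have "norm (b - a) < 1 / (norm (inv_el a) + 1)"
      by (simp add: e_def dist_norm norm_minus_commute)
    then have "(norm (inv_el a) + 1) * norm (b - a) < 1"
      using pos by (simp add: field_simps)
    moreover have "norm (inv_el a) * norm (b - a) \<le> (norm (inv_el a) + 1) * norm (b - a)"
      by (intro mult_right_mono) auto
    ultimately show "has_inv b"
      by (intro has_inv_nearby [OF a]) linarith
  qed
  then show "\<exists>e>0. ball a e \<subseteq> {a. has_inv a}"
    using pos by (intro exI [of _ e]) (simp add: e_def)
qed

text \<open>The resolvent identity: it yields continuity of inversion and, applied once more, its
  derivative.\<close>

lemma inv_el_diff:
  fixes a b :: "'a::{ring, monoid_mult}"
  assumes "has_inv a" "has_inv b"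
  shows "inv_el b - inv_el a = - (inv_el b * (b - a) * inv_el a)"
  using inv_el_right_left [OF assms(1)] inv_el_right_left [OF assms(2)]
  by (simp add: left_diff_distrib right_diff_distrib mult.assoc)

lemma eventually_has_inv:
  fixes a :: "'a::{real_normed_algebra, banach, monoid_mult}"
  assumes "has_inv a"
  shows "\<forall>\<^sub>F b in at a. has_inv b"
  using topological_tendstoD [OF tendsto_ident_at open_has_inv] assms by auto

lemma tendsto_inv_el:
  fixes a :: "'a::{real_normed_algebra, banach, monoid_mult}"
  assumes a: "has_inv a"
  shows "(inv_el \<longlongrightarrow> inv_el a) (at a)"
proof -
  let ?g = "norm (inv_el a)"
  have lim: "((\<lambda>b. ?g * norm (b - a)) \<longlongrightarrow> 0) (at a)"
    by (rule tendsto_eq_intros | simp)+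
  \<comment> \<open>Near \<open>a\<close> the resolvent identity bounds the difference by half of
    \<open>norm (inv_el b)\<close>, so \<open>norm (inv_el b)\<close> is at most
    \<open>2 * ?g\<close>. Inserting this into the same identity gives a bound linear in
    \<open>norm (b - a)\<close>.\<close>
  have bound: "norm (inv_el b - inv_el a) \<le> 2 * ?g * (?g * norm (b - a))"
    if b: "has_inv b" and small: "?g * norm (b - a) < 1 / 2" for b
  proof -
    have "norm (inv_el b - inv_el a) \<le> norm (inv_el b * (b - a)) * ?g"
      unfolding inv_el_diff [OF a b] norm_minus_cancel by (rule norm_mult_ineq)
    also have "\<dots> \<le> norm (inv_el b) * norm (b - a) * ?g"
      by (intro mult_right_mono norm_mult_ineq norm_ge_zero)
    finally have *: "norm (inv_el b - inv_el a) \<le> norm (inv_el b) * (?g * norm (b - a))"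
      by (simp add: mult_ac)
    also have "\<dots> \<le> norm (inv_el b) * (1 / 2)"
      using small by (intro mult_left_mono) auto
    finally have "norm (inv_el b) \<le> 2 * ?g"
      using norm_triangle_sub [of "inv_el b" "inv_el a"] by linarith
    then show ?thesis
      using * by (meson mult_right_mono norm_ge_zero mult_nonneg_nonneg order_trans)
  qed
  have small: "\<forall>\<^sub>F b in at a. ?g * norm (b - a) < 1 / 2"
    by (rule order_tendstoD(2) [OF lim]) simp
  have "((\<lambda>b. norm (inv_el b - inv_el a)) \<longlongrightarrow> 0) (at a)"
  proof (rule tendsto_sandwich [OF _ _ tendsto_const])
    show "\<forall>\<^sub>F b in at a. norm (inv_el b - inv_el a) \<le> 2 * ?g * (?g * norm (b - a))"
      using eventually_has_inv [OF a] small
      by eventually_elim (auto intro: bound)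
    show "((\<lambda>b. 2 * ?g * (?g * norm (b - a))) \<longlongrightarrow> 0) (at a)"
      using tendsto_mult_left [OF lim, of "2 * ?g"] by simp
  qed simp
  then show ?thesis
    by (simp add: tendsto_norm_zero_iff LIM_zero_iff)
qed

lemma has_derivative_inv_el:
  fixes a :: "'a::{real_normed_algebra, banach, monoid_mult}"
  assumes a: "has_inv a"
  shows "(inv_el has_derivative (\<lambda>h. - (inv_el a * h * inv_el a))) (at a)"
  unfolding has_derivative_iff_norm
proof
  let ?g = "inv_el a"
  show "bounded_linear (\<lambda>h. - (?g * h * ?g))"
    by (intro bounded_linear_minus bounded_linear_mult_const bounded_linear_const_mult
        bounded_linear_ident)
  \<comment> \<open>By the resolvent identity the remainder is
    \<open>(?g - inv_el b) * (b - a) * ?g\<close>, so the quotient tends to zero by continuity of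
    inversion. At \<open>b = a\<close> the quotient is \<open>0 / 0 = 0\<close>.\<close>
  have bound: "norm (inv_el b - ?g - - (?g * (b - a) * ?g)) / norm (b - a)
      \<le> norm (inv_el b - ?g) * norm ?g" if b: "has_inv b" for b
  proof -
    have "inv_el b - ?g - - (?g * (b - a) * ?g) = (?g - inv_el b) * (b - a) * ?g"
      unfolding inv_el_diff [OF a b] by (simp add: algebra_simps)
    also have "norm \<dots> \<le> norm (?g - inv_el b) * norm (b - a) * norm ?g"
      by (meson norm_mult_ineq mult_right_mono norm_ge_zero order_trans)
    finally show ?thesis
      by (cases "b = a") (auto simp: field_simps norm_minus_commute)
  qed
  show "((\<lambda>b. norm (inv_el b - ?g - - (?g * (b - a) * ?g)) / norm (b - a)) \<longlongrightarrow> 0) (at a)"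
  proof (rule tendsto_sandwich [OF _ _ tendsto_const])
    show "\<forall>\<^sub>F b in at a. norm (inv_el b - ?g - - (?g * (b - a) * ?g)) / norm (b - a)
      \<le> norm (inv_el b - ?g) * norm ?g"
      using eventually_has_inv [OF a] by eventually_elim (rule bound)
    have "((\<lambda>b. norm (inv_el b - ?g) * norm ?g) \<longlongrightarrow> norm (?g - ?g) * norm ?g) (at a)"
      by (intro tendsto_intros tendsto_inv_el a)
    then show "((\<lambda>b. norm (inv_el b - ?g) * norm ?g) \<longlongrightarrow> 0) (at a)" by simp
  qed simp
qed

lemma has_vector_derivative_inv_el:
  fixes f :: "real \<Rightarrow> 'a::{real_normed_algebra, banach, monoid_mult}"
  assumes f: "(f has_vector_derivative D) (at x)" and inv: "has_inv (f x)"
  shows "((\<lambda>y. inv_el (f y)) has_vector_derivative - (inv_el (f x) * D * inv_el (f x))) (at x)"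
  using has_derivative_compose [OF f [unfolded has_vector_derivative_def]
      has_derivative_inv_el [OF inv]]
  by (simp add: has_vector_derivative_def)

section \<open>\<open>\<B>(V_n)\<close> as a Banach algebra\<close>

lemma clop_of_diff: "clop_of (S - T) = clop_of S - clop_of T"
  and clop_of_cprod: "clop_of (cprod (o\<^sub>L) S T) = clop_of S * clop_of T"
  and clop_of_id: "clop_of (blade {} id_blinfun) = 1"
  by (rule clop_eqI;
      simp add: act_diff act_compose act_blade_id)+

lemma comps_diff: "comps (F - G) = comps F - comps G"
  and comps_times: "comps (F * G) = cprod (o\<^sub>L) (comps F) (comps G)"
  and comps_one: "comps 1 = blade {} id_blinfun"
  by (metis clop_of_comps comps_clop_of clop_of_diff clop_of_cprod clop_of_id)+

lemma abs_csign: "\<bar>csign A B\<bar> = 1"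
  using csign_sq [of A B] by (simp flip: power2_eq_square) (auto simp: power2_eq_1_iff)

instance clop :: (real_normed_vector, "{finite,linorder}") real_normed_algebra
proof
  fix F G H :: "('a, 'b) clop" and r :: real
  show "(F + G) * H = F * H + G * H" by (rule clop_eqI) simp
  show "F * (G + H) = F * G + F * H"
    by (rule clop_eqI, rule cliff_eqI)
       (simp add: app_eq_act [of F] act_def cf_cprod blinfun.bilinear_simps algebra_simps sum.distrib)
  show "r *\<^sub>R F * G = r *\<^sub>R (F * G)" by (rule clop_eqI) simp
  show "F * r *\<^sub>R G = r *\<^sub>R (F * G)"
    by (rule clop_eqI, rule cliff_eqI)
       (simp add: app_eq_act [of F] act_def cf_cprod blinfun.bilinear_simps scaleR_sum_right mult.commute)
  \<comment> \<open>Signs have modulus one, so the norm of each coefficient of the product is at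
    most a sum of products of norms. For fixed \<open>A\<close> the map \<open>sym_diff A\<close>
    permutes the index sets, hence the inner sum is \<open>norm G\<close>.\<close>
  let ?f = "\<lambda>A. norm (cf (comps F) A)" and ?g = "\<lambda>A. norm (cf (comps G) A)"
  have "norm (F * G) \<le> (\<Sum>C\<in>UNIV. \<Sum>A\<in>UNIV. ?f A * ?g (sym_diff A C))"
    unfolding norm_clop_def comps_times cf_cprod
    by (intro sum_mono order_trans [OF norm_sum])
       (simp add: abs_csign norm_blinfun_compose)
  also have "\<dots> = (\<Sum>A\<in>UNIV. \<Sum>C\<in>UNIV. ?f A * ?g (sym_diff A C))"
    by (rule sum.swap)
  also have "\<dots> = (\<Sum>A\<in>UNIV. ?f A * norm G)"
  proof (rule sum.cong [OF refl])
    fix A :: "'b set"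
    have "(\<Sum>C\<in>UNIV. ?g (sym_diff A C)) = (\<Sum>C\<in>UNIV. ?g C)"
      by (rule sum.reindex_bij_witness [where i = "sym_diff A" and j = "sym_diff A"])
         (simp_all only: sym_diff_cancel UNIV_I)
    then show "(\<Sum>C\<in>UNIV. ?f A * ?g (sym_diff A C)) = ?f A * norm G"
      by (simp add: norm_clop_def flip: sum_distrib_left)
  qed
  also have "\<dots> = norm F * norm G"
    by (simp add: norm_clop_def sum_distrib_right)
  finally show "norm (F * G) \<le> norm F * norm G" .
qed

text \<open>Only an inequality: on the zero space the identity has norm \<open>0\<close>.\<close>

lemma norm_one_clop_le: "norm (1 :: ('v::real_normed_vector, 'n::{finite,linorder}) clop) \<le> 1"
proof -
  have "norm (1 :: ('v, 'n) clop) = (\<Sum>A\<in>(UNIV :: 'n set set). if A = {} then norm (id_blinfun :: 'v \<Rightarrow>\<^sub>L 'v) else 0)"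
    unfolding norm_clop_def comps_one by (rule sum.cong) auto
  also have "\<dots> \<le> 1"
    by (simp add: norm_blinfun_id_le)
  finally show ?thesis .
qed

text \<open>The norm is a finite sum of coefficient norms, so limits can be taken coefficient by
  coefficient.\<close>

instance clop :: (banach, "{finite,linorder}") banach
proof
  fix X :: "nat \<Rightarrow> ('a, 'b) clop"
  assume X: "Cauchy X"
  have le: "norm (cf (comps F) A) \<le> norm F" for F :: "('a, 'b) clop" and A
    unfolding norm_clop_def by (rule member_le_sum) auto
  have "Cauchy (\<lambda>i. cf (comps (X i)) A)" for A
  proof (rule metric_CauchyI)
    fix e :: real
    assume "e > 0"
    then obtain M where "\<forall>m\<ge>M. \<forall>n\<ge>M. dist (X m) (X n) < e"
      using X unfolding Cauchy_def by blast
    moreover have "dist (cf (comps F) A) (cf (comps G) A) \<le> dist F G" for F G :: "('a, 'b) clop"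
      using le [of "F - G" A] by (simp add: dist_norm comps_diff)
    ultimately show "\<exists>M. \<forall>m\<ge>M. \<forall>n\<ge>M. dist (cf (comps (X m)) A) (cf (comps (X n)) A) < e"
      by (meson le_less_trans)
  qed
  then have "convergent (\<lambda>i. cf (comps (X i)) A)" for A
    by (simp add: Cauchy_convergent_iff)
  then obtain L where L: "(\<lambda>i. cf (comps (X i)) A) \<longlonglongrightarrow> L A" for A
    unfolding convergent_def by metis
  have "(\<lambda>i. norm (X i - clop_of (Cliff L))) \<longlonglongrightarrow> (\<Sum>A\<in>(UNIV :: 'b set set). norm (L A - L A))"
    unfolding norm_clop_def comps_diff comps_clop_of cf_simps cf_Cliff
    by (intro tendsto_intros L)
  then have "X \<longlonglongrightarrow> clop_of (Cliff L)"
    by (simp add: tendsto_norm_zero_iff LIM_zero_iff)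
  then show "convergent X" unfolding convergent_def by blast
qed

section \<open>Clifford numbers and two-sided linear operators\<close>

lemma cnum_mult:
  "cnum (a * b) = (cnum a * cnum b :: ('v::real_normed_vector, 'n::{finite,linorder}) clop)"
proof (rule clop_eqI)
  fix x :: "('v, 'n) cliff"
  have "lmul (a * b) x = lmul a (lmul b x)"
    unfolding lmul_def times_cliff_def
    by (rule cprod_assoc) (auto intro!: linearI simp: algebra_simps)
  then show "app (cnum (a * b)) x = app (cnum a * cnum b) x" by simp
qed

lemma cnum_add: "cnum (a + b) = cnum a + cnum b"
  and cnum_scaleR: "cnum (r *\<^sub>R a) = r *\<^sub>R cnum a"
  by (rule clop_eqI, rule cliff_eqI,
      simp add: lmul_def cf_cprod algebra_simps sum.distrib scaleR_sum_right)+

lemma cnum_one: "cnum 1 = 1"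
  by (rule clop_eqI, rule cliff_eqI) (simp add: lmul_def one_cliff_def cprod_blade_left)

lemma cnum_zero: "cnum 0 = 0"
  using cnum_scaleR [of 0 0] by simp

lemma cnum_uminus: "cnum (- a) = - cnum a"
  using cnum_scaleR [of "- 1" a] by simp

lemma cnum_sum: "cnum (\<Sum>i\<in>I. f i) = (\<Sum>i\<in>I. cnum (f i))"
  by (induction I rule: infinite_finite_induct) (auto simp: cnum_zero cnum_add)

lemma cnum_of_real: "cnum (of_real r) = r *\<^sub>R 1"
  by (simp add: of_real_def cnum_scaleR cnum_one)

lemma cnum_power: "cnum (a ^ n) = cnum a ^ n"
  by (induction n) (simp_all add: cnum_one cnum_mult)

text \<open>Every element of \<B>(V_n) is already right linear, so only commutation with left
  multiplications remains.\<close>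

lemma two_sided_linear_iff: "two_sided_linear F \<longleftrightarrow> (\<forall>a. cnum a * F = F * cnum a)"
proof -
  have "app F (rmul x a) = rmul (app F x) a" for x a
    by (simp add: app_eq_act act_rmul)
  moreover have "(cnum a * F = F * cnum a) \<longleftrightarrow> (\<forall>x. app F (lmul a x) = lmul a (app F x))" for a
    by (metis app_cnum app_times clop_eqI)
  ultimately show ?thesis
    unfolding two_sided_linear_def by blast
qed

lemma two_sided_linearD: "two_sided_linear F \<Longrightarrow> cnum a * F = F * cnum a"
  by (simp add: two_sided_linear_iff)

lemma two_sided_linear_left_commute:
  "two_sided_linear F \<Longrightarrow> F * (cnum a * G) = cnum a * (F * G)"
  by (simp add: two_sided_linearD flip: mult.assoc)

lemma two_sided_linear_one: "two_sided_linear 1"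
  and two_sided_linear_zero: "two_sided_linear 0"
  by (simp_all add: two_sided_linear_iff)

lemma two_sided_linear_add: "two_sided_linear F \<Longrightarrow> two_sided_linear G \<Longrightarrow> two_sided_linear (F + G)"
  and two_sided_linear_diff: "two_sided_linear F \<Longrightarrow> two_sided_linear G \<Longrightarrow> two_sided_linear (F - G)"
  and two_sided_linear_uminus: "two_sided_linear F \<Longrightarrow> two_sided_linear (- F)"
  and two_sided_linear_scaleR: "two_sided_linear F \<Longrightarrow> two_sided_linear (r *\<^sub>R F)"
  by (simp_all add: two_sided_linear_iff algebra_simps)

lemma two_sided_linear_mult:
  assumes "two_sided_linear F" "two_sided_linear G"
  shows "two_sided_linear (F * G)"
  using assms unfolding two_sided_linear_iff by (metis mult.assoc)

lemma two_sided_linear_inv_el: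
  assumes "has_inv F" "two_sided_linear F"
  shows "two_sided_linear (inv_el F)"
  using assms unfolding two_sided_linear_iff by (metis inv_el_commute)

lemma two_sided_linear_sum:
  "(\<And>i. i \<in> I \<Longrightarrow> two_sided_linear (f i)) \<Longrightarrow> two_sided_linear (\<Sum>i\<in>I. f i)"
  by (induction I rule: infinite_finite_induct)
     (auto intro: two_sided_linear_zero two_sided_linear_add)

lemmas two_sided_linear_intros =
  two_sided_linear_one two_sided_linear_zero two_sided_linear_add two_sided_linear_diff
  two_sided_linear_uminus two_sided_linear_scaleR two_sided_linear_mult two_sided_linear_sum

lemma two_sided_linear_cemb: "two_sided_linear (cemb S)"
  unfolding two_sided_linear_iff
  by (intro allI clop_eqI cliff_eqI)
     (simp add: app_cemb lmul_def cf_cprod blinfun.bilinear_simps)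

lemma cemb_compose: "cemb (S o\<^sub>L R) = cemb S * cemb R"
  and cemb_uminus: "cemb (- S) = - cemb S"
  by (rule clop_eqI, rule cliff_eqI, simp add: app_cemb blinfun.bilinear_simps)+

text \<open>Symmetrising the double sum leaves only the anticommutators of the generators.\<close>

lemma vector_square:
  fixes S :: "'n::{finite,linorder} \<Rightarrow> ('v::real_normed_vector, 'n) clop"
  assumes lin: "\<And>\<mu>. two_sided_linear (S \<mu>)" and comm: "\<And>\<mu> \<nu>. S \<mu> * S \<nu> = S \<nu> * S \<mu>"
  shows "(\<Sum>\<mu>\<in>UNIV. cnum (gen \<mu>) * S \<mu>) * (\<Sum>\<mu>\<in>UNIV. cnum (gen \<mu>) * S \<mu>)
    = - (\<Sum>\<mu>\<in>UNIV. S \<mu> * S \<mu>)" (is "?V * ?V = - ?D")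
proof -
  let ?t = "\<lambda>\<mu> \<nu>. cnum (gen \<mu> * gen \<nu>) * (S \<mu> * S \<nu>)"
  have "cnum (gen \<mu>) * S \<mu> * (cnum (gen \<nu>) * S \<nu>) = ?t \<mu> \<nu>" for \<mu> \<nu>
    by (simp add: cnum_mult mult.assoc two_sided_linear_left_commute [OF lin])
  then have V: "?V * ?V = (\<Sum>\<mu>\<in>UNIV. \<Sum>\<nu>\<in>UNIV. ?t \<mu> \<nu>)"
    by (simp add: sum_distrib_left sum_distrib_right) (rule sum.swap)
  then have V': "?V * ?V = (\<Sum>\<mu>\<in>UNIV. \<Sum>\<nu>\<in>UNIV. ?t \<nu> \<mu>)"
    using sum.swap [of ?t] by simp
  have "2 *\<^sub>R (?V * ?V) = ?V * ?V + ?V * ?V"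
    by (simp add: scaleR_2)
  also have "\<dots> = (\<Sum>\<mu>\<in>UNIV. \<Sum>\<nu>\<in>UNIV. ?t \<mu> \<nu> + ?t \<nu> \<mu>)"
    by (subst V, subst V') (simp add: sum.distrib)
  also have "\<dots> = (\<Sum>\<mu>\<in>UNIV. \<Sum>\<nu>\<in>UNIV. if \<mu> = \<nu> then - 2 *\<^sub>R (S \<mu> * S \<mu>) else 0)"
  proof (intro sum.cong refl)
    fix \<mu> \<nu> :: 'n
    have "?t \<mu> \<nu> + ?t \<nu> \<mu> = cnum (gen \<mu> * gen \<nu> + gen \<nu> * gen \<mu>) * (S \<mu> * S \<nu>)"
      by (simp add: cnum_add comm [of \<nu> \<mu>] distrib_right)
    also have "\<dots> = (if \<mu> = \<nu> then - 2 *\<^sub>R (S \<mu> * S \<mu>) else 0)"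
    proof -
      \<comment> \<open>Writing the anticommutator as a real number lets \<open>cnum\<close> turn it
        into a scalar multiple of the identity.\<close>
      have "(- 2 :: (real, 'n) cliff) = of_real (- 2)" by simp
      then show ?thesis
        unfolding gen_anticommute by (simp only: cnum_of_real cnum_zero if_distrib split: if_split) simp
    qed
    finally show "?t \<mu> \<nu> + ?t \<nu> \<mu> = (if \<mu> = \<nu> then - 2 *\<^sub>R (S \<mu> * S \<mu>) else 0)" .
  qed
  also have "\<dots> = 2 *\<^sub>R (- ?D)"
    by (simp add: sum_negf scaleR_sum_right)
  finally show ?thesis by (simp only: scaleR_cancel_left) simp
qed

section \<open>Imaginary vectors and paravectors as operators\<close>

lemma cnum_imvec: "cnum (imvec x) = (\<Sum>\<mu>\<in>UNIV. (x $ \<mu>) *\<^sub>R cnum (gen \<mu>))"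
  by (simp add: imvec_def cnum_sum cnum_scaleR)

lemma imvec_simps:
  "imvec (x + y) = imvec x + imvec y" "imvec (- x) = - imvec x" "imvec (r *\<^sub>R x) = r *\<^sub>R imvec x"
  by (simp_all add: imvec_def sum.distrib scaleR_sum_right algebra_simps sum_negf)

lemma cnum_imvec_square: "cnum (imvec x) * cnum (imvec x) = - ((norm x)\<^sup>2 *\<^sub>R 1)"
proof -
  have V: "cnum (imvec x) = (\<Sum>\<mu>\<in>UNIV. cnum (gen \<mu>) * ((x $ \<mu>) *\<^sub>R 1))"
    by (simp add: cnum_imvec)
  have "cnum (imvec x) * cnum (imvec x) = - (\<Sum>\<mu>\<in>UNIV. ((x $ \<mu>) *\<^sub>R 1) * ((x $ \<mu>) *\<^sub>R 1))"
    unfolding V by (rule vector_square) (simp_all add: two_sided_linear_intros mult.commute)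
  then show ?thesis
    by (simp add: power2_norm_eq_inner inner_vec_def scaleR_sum_left)
qed

text \<open>On the Clifford algebra itself, left multiplication applied to \<open>1\<close> returns
  the number. Identities proved for operators thus pull back to Clifford numbers.\<close>

lemma cnum_inject_real:
  fixes a b :: "(real, 'n::{finite,linorder}) cliff"
  assumes "cnum a = (cnum b :: (real, 'n) clop)"
  shows "a = b"
proof -
  have "lmul c 1 = c * 1" for c :: "(real, 'n) cliff"
    by (simp add: lmul_def times_cliff_def cprod_def)
  then show ?thesis
    using arg_cong [OF assms, of "\<lambda>F. app F 1"] by simp
qed

lemma imvec_square:
  fixes x :: "real ^ 'n::{finite,linorder}"
  shows "imvec x * imvec x = of_real (- (norm x)\<^sup>2)"
  by (rule cnum_inject_real)
     (simp only: cnum_mult cnum_imvec_square cnum_of_real scaleR_minus_left)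

lemma cnum_paravec: "cnum (paravec (u, x)) = u *\<^sub>R 1 + cnum (imvec x)"
  by (simp add: paravec_def cnum_add cnum_of_real)

section \<open>Paravector operators\<close>

lemma pvop_uminus: "pvop S0 (\<lambda>\<mu>. - S \<mu>) = cemb S0 - (\<Sum>\<mu>\<in>UNIV. cnum (gen \<mu>) * cemb (S \<mu>))"
  by (simp add: pvop_def cemb_uminus sum_negf)

lemma cconj_pvop: "cconj (pvop S0 S) = pvop S0 (\<lambda>\<mu>. - S \<mu>)"
  by (simp add: cconj_def pvop_uminus)

text \<open>Conjugation only flips the signs of the coefficients at nonempty index sets.\<close>

lemma norm_cconj:
  assumes "T \<in> BC01"
  shows "norm (cconj T) = norm T"
proof -
  obtain S0 S where T: "T = pvop S0 S" using assms unfolding BC01_def by blast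
  have "norm (cf (comps (cconj T)) A) = norm (cf (comps T) A)" for A
  proof (cases "A = {}")
    case False
    have "cf (comps (cconj T)) A = - cf (comps T) A"
      using False unfolding T cconj_pvop comps_pvop by (simp flip: sum_negf) (rule sum.cong, simp_all)
    then show ?thesis by simp
  qed (simp add: T cconj_pvop comps_pvop)
  then show ?thesis by (simp add: norm_clop_def)
qed

lemma BC01_properties:
  assumes "T \<in> BC01"
  shows T_plus_cconj: "T + cconj T = 2 *\<^sub>R cemb (scalar_part T)"
    and T_cconj_commute: "T * cconj T = cconj T * T"
    and two_sided_linear_T_cconj: "two_sided_linear (T * cconj T)"
    and T_scalar_part_commute: "T * cemb (scalar_part T) = cemb (scalar_part T) * T"
    and cconj_scalar_part_commute: "cconj T * cemb (scalar_part T) = cemb (scalar_part T) * cconj T"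
proof -
  obtain S0 S where T: "T = pvop S0 S" and comm0: "\<And>\<mu>. S0 o\<^sub>L S \<mu> = S \<mu> o\<^sub>L S0"
    and comm: "\<And>\<mu> \<nu>. S \<mu> o\<^sub>L S \<nu> = S \<nu> o\<^sub>L S \<mu>"
    using assms unfolding BC01_def by blast
  \<comment> \<open>With \<open>T = ?S0 + V\<close> and \<open>cconj T = ?S0 - V\<close>, everything
    follows from two facts: \<open>V\<close> commutes with \<open>?S0\<close>, and
    \<open>V * V\<close> contains no generators.\<close>
  define V where "V = (\<Sum>\<mu>\<in>UNIV. cnum (gen \<mu>) * cemb (S \<mu>))"
  let ?S0 = "cemb S0"
  have sp: "scalar_part T = S0" by (simp add: T)
  have TV: "T = ?S0 + V" "cconj T = ?S0 - V"
    by (simp_all add: T V_def cconj_pvop pvop_uminus) (simp add: pvop_def)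
  have V0: "V * ?S0 = ?S0 * V"
    unfolding V_def sum_distrib_left sum_distrib_right
    by (intro sum.cong refl)
       (simp add: mult.assoc two_sided_linear_left_commute two_sided_linear_cemb comm0
         flip: cemb_compose)
  have VV: "V * V = - (\<Sum>\<mu>\<in>UNIV. cemb (S \<mu>) * cemb (S \<mu>))"
    unfolding V_def
    by (rule vector_square) (auto simp: comm simp flip: cemb_compose intro: two_sided_linear_cemb)
  show "T + cconj T = 2 *\<^sub>R cemb (scalar_part T)"
    unfolding sp TV(2) unfolding TV(1) by (simp add: scaleR_2)
  show "T * cconj T = cconj T * T"
    unfolding TV(2) unfolding TV(1) by (simp add: algebra_simps V0)
  have "T * cconj T = ?S0 * ?S0 - V * V"
    unfolding TV(2) unfolding TV(1) by (simp add: algebra_simps V0)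
  then show "two_sided_linear (T * cconj T)"
    unfolding VV by (auto intro!: two_sided_linear_intros two_sided_linear_cemb)
  show "T * cemb (scalar_part T) = cemb (scalar_part T) * T"
    "cconj T * cemb (scalar_part T) = cemb (scalar_part T) * cconj T"
    unfolding sp TV(2) unfolding TV(1) by (simp_all add: algebra_simps V0)
qed

section \<open>The polynomials \<open>H\<close> as a convolution\<close>

text \<open>The coefficient of \<open>X ^ j\<close> in \<open>(1 - X) ^ (- l)\<close>.\<close>

definition inv_power_coeff :: "nat \<Rightarrow> nat \<Rightarrow> real" where
  "inv_power_coeff l j = (if l = 0 then of_bool (j = 0) else real ((l + j - 1) choose (l - 1)))"

lemma inv_power_coeff_0_right [simp]: "inv_power_coeff l 0 = 1"
  by (simp add: inv_power_coeff_def)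

lemma inv_power_coeff_0_left: "inv_power_coeff 0 j = of_bool (j = 0)"
  by (simp add: inv_power_coeff_def)

text \<open>Pascal's rule, or the coefficient form of
  \<open>(1 - X) * (1 - X) ^ (- (l + 1)) = (1 - X) ^ (- l)\<close>.\<close>

lemma inv_power_coeff_Suc_Suc:
  "inv_power_coeff (Suc l) (Suc j) = inv_power_coeff (Suc l) j + inv_power_coeff l (Suc j)"
  by (cases l) (simp_all add: inv_power_coeff_def)

lemma inv_power_coeff_nonneg: "0 \<le> inv_power_coeff l j"
  by (simp add: inv_power_coeff_def)

lemma summable_inv_power_coeff:
  fixes q :: real
  assumes "0 \<le> q" "q < 1"
  shows "summable (\<lambda>j. inv_power_coeff l j * q ^ j)"
proof (induction l)
  case 0
  show ?case
    by (rule summable_finite [of "{0}"]) (auto simp: inv_power_coeff_0_left)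
next
  case (Suc l)
  \<comment> \<open>Taking partial sums of coefficients amounts to a Cauchy product with the
    geometric series.\<close>
  have sum: "inv_power_coeff (Suc l) j = (\<Sum>i\<le>j. inv_power_coeff l i)" for j
    by (induction j) (simp_all add: inv_power_coeff_Suc_Suc)
  have "summable (\<lambda>j. \<Sum>i\<le>j. (inv_power_coeff l i * q ^ i) * q ^ (j - i))"
    using Suc assms
    by (intro summable_Cauchy_product) (simp_all add: abs_mult inv_power_coeff_nonneg summable_geometric)
  moreover have "(\<Sum>i\<le>j. (inv_power_coeff l i * q ^ i) * q ^ (j - i)) = inv_power_coeff (Suc l) j * q ^ j" for j
    unfolding sum sum_distrib_right
    by (rule sum.cong) (simp_all add: mult.assoc flip: power_add)
  ultimately show ?case by simp
qed

text \<open>The coefficient of \<open>t ^ m\<close> in \<open>(1 - t x) ^ (- l) * (1 - t y) ^ (- l')\<close>.\<close>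

definition inv_power_conv ::
  "nat \<Rightarrow> nat \<Rightarrow> 'a::{real_algebra, monoid_mult} \<Rightarrow> 'a \<Rightarrow> nat \<Rightarrow> 'a" where
  "inv_power_conv l l' x y m =
    (\<Sum>j\<le>m. (inv_power_coeff l (m - j) * inv_power_coeff l' j) *\<^sub>R (x ^ (m - j) * y ^ j))"

lemma inv_power_conv_0 [simp]: "inv_power_conv l l' x y 0 = 1"
  by (simp add: inv_power_conv_def)

lemma inv_power_conv_00: "inv_power_conv 0 0 x y m = (if m = 0 then 1 else 0)"
  unfolding inv_power_conv_def by (cases "m = 0") (auto intro!: sum.neutral simp: inv_power_coeff_0_left)

text \<open>Multiplying by \<open>1 - t x\<close> lowers the first exponent by one. No commutation
  is involved, as the powers of \<open>x\<close> stand on the left; the term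
  \<open>j = Suc m\<close> has no factor \<open>x\<close> and comes entirely from the last
  summand.\<close>

lemma inv_power_conv_left:
  "inv_power_conv (Suc l) l' x y (Suc m)
    = x * inv_power_conv (Suc l) l' x y m + inv_power_conv l l' x y (Suc m)"
proof -
  have "(inv_power_coeff (Suc l) (Suc m - j) * inv_power_coeff l' j) *\<^sub>R (x ^ (Suc m - j) * y ^ j)
      = x * ((inv_power_coeff (Suc l) (m - j) * inv_power_coeff l' j) *\<^sub>R (x ^ (m - j) * y ^ j))
        + (inv_power_coeff l (Suc m - j) * inv_power_coeff l' j) *\<^sub>R (x ^ (Suc m - j) * y ^ j)"
    if "j \<le> m" for j
    using that by (simp add: Suc_diff_le inv_power_coeff_Suc_Suc algebra_simps)
  then show ?thesis
    by (simp add: inv_power_conv_def sum.distrib sum_distrib_left)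
qed

lemma inv_power_conv_swap:
  assumes "x * y = y * x"
  shows "inv_power_conv l l' x y m = inv_power_conv l' l y x m"
proof -
  have xy: "x ^ i * y ^ j = y ^ j * x ^ i" for i j
    by (metis assms power_commute)
  show ?thesis
    unfolding inv_power_conv_def
    by (rule sum.reindex_bij_witness [where i = "\<lambda>j. m - j" and j = "\<lambda>j. m - j"])
       (auto simp: xy mult.commute)
qed

lemma inv_power_conv_right:
  assumes "x * y = y * x"
  shows "inv_power_conv l (Suc l') x y (Suc m)
    = y * inv_power_conv l (Suc l') x y m + inv_power_conv l l' x y (Suc m)"
  using inv_power_conv_left [of l' l y x m] by (simp add: inv_power_conv_swap [OF assms])

lemma inv_power_conv_1:
  assumes "x * y = y * x"
  shows "inv_power_conv (Suc l) (Suc l) x y 1 = x + y + inv_power_conv l l x y 1"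
  using inv_power_conv_left [of l "Suc l" x y 0] inv_power_conv_right [OF assms, of l l 0] by simp

text \<open>Lowering both exponents multiplies by
  \<open>(1 - t x) * (1 - t y) = 1 - t (x + y) + t^2 x y\<close>, so \<open>x\<close> and
  \<open>y\<close> enter the recursion only through their sum and product.\<close>

lemma inv_power_conv_Suc_Suc:
  assumes "x * y = y * x"
  shows "inv_power_conv (Suc l) (Suc l) x y (Suc (Suc m))
    = (x + y) * inv_power_conv (Suc l) (Suc l) x y (Suc m)
      - (x * y) * inv_power_conv (Suc l) (Suc l) x y m + inv_power_conv l l x y (Suc (Suc m))"
proof -
  let ?p = "inv_power_conv (Suc l) (Suc l) x y" and ?q = "inv_power_conv l (Suc l) x y"
  have q: "?q (Suc m) = ?p (Suc m) - x * ?p m"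
    by (simp add: inv_power_conv_left)
  have yx: "y * (x * z) = x * (y * z)" for z
    by (metis assms mult.assoc)
  have "?p (Suc (Suc m)) = x * ?p (Suc m) + ?q (Suc (Suc m))"
    by (rule inv_power_conv_left)
  also have "\<dots> = x * ?p (Suc m) + (y * (?p (Suc m) - x * ?p m) + inv_power_conv l l x y (Suc (Suc m)))"
    unfolding inv_power_conv_right [OF assms, of l l "Suc m"] q ..
  finally show ?thesis
    by (simp add: algebra_simps yx)
qed

lemma inv_power_conv_commute:
  assumes "x * z = z * x" "y * z = z * y"
  shows "inv_power_conv l l' x y m * z = z * inv_power_conv l l' x y m"
  unfolding inv_power_conv_def sum_distrib_left sum_distrib_right
proof (intro sum.cong refl)
  fix j
  have "x ^ (m - j) * y ^ j * z = z * (x ^ (m - j) * y ^ j)"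
    using power_commute [OF assms(1)] power_commute [OF assms(2)] by (metis mult.assoc)
  then show "(inv_power_coeff l (m - j) * inv_power_coeff l' j) *\<^sub>R (x ^ (m - j) * y ^ j) * z =
    z * (inv_power_coeff l (m - j) * inv_power_coeff l' j) *\<^sub>R (x ^ (m - j) * y ^ j)"
    by simp
qed

text \<open>For \<open>k = 2 * l - 1 + m\<close> the degree \<open>k + 1 - 2 * l\<close> is
  \<open>m\<close>, and \<open>k - l - j = l + (m - j) - 1\<close> makes the second binomial the
  coefficient of the factor in \<open>T\<close>. The bound \<open>1 \<le> l\<close> keeps the
  natural subtractions exact.\<close>

lemma Hpoly_eq_inv_power_conv:
  assumes "1 \<le> l"
  shows "Hpoly l (2 * l - 1 + m) T = inv_power_conv l l T (cconj T) m"
proof -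
  have "2 * l - 1 + m + 1 - 2 * l = m" using assms by simp
  moreover have "2 * l - 1 + m - l - j = l + (m - j) - 1" if "j \<le> m" for j
    using assms that by simp
  ultimately show ?thesis
    using assms unfolding Hpoly_def inv_power_conv_def
    by (auto intro!: sum.cong simp: inv_power_coeff_def atLeast0AtMost mult.commute)
qed

section \<open>The series expansion\<close>

lemma paravec_mult_conj:
  fixes x :: "real ^ 'n::{finite,linorder}"
  shows "paravec (u, x) * paravec (u, - x) = of_real ((norm (u, x))\<^sup>2)"
proof -
  have "paravec (u, x) * paravec (u, - x) = of_real (u * u) - imvec x * imvec x"
    by (simp add: paravec_def imvec_simps algebra_simps of_real_def)
  also have "\<dots> = of_real ((norm (u, x))\<^sup>2)"
    unfolding imvec_square by (simp add: norm_Pair power2_eq_square flip: of_real_mult of_real_add)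
  finally show ?thesis .
qed

lemma paravec_inverse:
  fixes x :: "real ^ 'n::{finite,linorder}"
  assumes "(u, x) \<noteq> 0"
  defines "r \<equiv> (1 / (norm (u, x))\<^sup>2) *\<^sub>R paravec (u, - x)"
  shows "paravec (u, x) * r = 1" "r * paravec (u, x) = 1" "inv_el (paravec (u, x)) = r"
proof -
  have nz: "norm (u, x) \<noteq> 0" using assms by simp
  have "norm (u, - x) = norm (u, x)" by (simp add: norm_Pair)
  then have "paravec (u, - x) * paravec (u, x) = of_real ((norm (u, x))\<^sup>2)"
    using paravec_mult_conj [of u "- x"] by simp
  then show "paravec (u, x) * r = 1" "r * paravec (u, x) = 1"
    using nz by (simp_all add: r_def paravec_mult_conj of_real_def)
  then show "inv_el (paravec (u, x)) = r" by (rule inv_el_unique)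
qed

lemma obtain_direction:
  fixes x :: "real ^ 'n"
  obtains J where "J \<in> sphere 0 1" "x = norm x *\<^sub>R J"
proof (cases "x = 0")
  case True
  show ?thesis
    by (rule that [of "axis undefined 1"]) (simp_all add: True norm_axis_1)
next
  case False
  then show ?thesis
    by (intro that [of "(1 / norm x) *\<^sub>R x"]) simp_all
qed

section \<open>Convergence of the series\<close>

lemma cnum_imvec_sphere:
  "J \<in> sphere 0 1 \<Longrightarrow> cnum (imvec J) * cnum (imvec J) = - 1"
  by (simp add: cnum_imvec_square)

lemma imaginary_unit_power:
  fixes E :: "'a::{real_algebra, monoid_mult}"
  assumes E: "E * E = - 1"
  shows "(Re z *\<^sub>R 1 + Im z *\<^sub>R E) ^ m = Re (z ^ m) *\<^sub>R 1 + Im (z ^ m) *\<^sub>R E"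
proof (induction m)
  case (Suc m)
  then show ?case
    by (simp add: algebra_simps E)
qed simp

text \<open>The norm is a sum of coefficient norms and only submultiplicative, so
  \<open>norm (R ^ m) \<le> norm R ^ m\<close> would be too weak for convergence up to
  \<open>norm T < norm s\<close>. Instead, the inverse of \<open>s\<close> is a complex number
  \<open>z\<close> in the plane spanned by \<open>1\<close> and \<open>E\<close>, and its powers
  follow those of \<open>z\<close>, of modulus \<open>(1 / norm s) ^ m\<close>.\<close>

lemma norm_power_inv_paravec:
  fixes s :: "real \<times> (real ^ 'n::{finite,linorder})"
  assumes "s \<noteq> 0"
  obtains C where "\<And>m. norm (cnum (inv_el (paravec s)) ^ m :: ('v::real_normed_vector, 'n) clop)
    \<le> C * (1 / norm s) ^ m"
proof -
  obtain u x where s: "s = (u, x)" by (cases s)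
  obtain J where J: "J \<in> sphere 0 1" and x: "x = norm x *\<^sub>R J" by (rule obtain_direction)
  define E :: "('v, 'n) clop" where "E = cnum (imvec J)"
  define z where "z = inverse (Complex u (norm x))"
  have Complex_norm: "cmod (Complex u (norm x)) = norm s"
    by (simp add: s norm_Pair complex_norm)
  then have z: "cmod z = 1 / norm s"
    by (simp add: z_def norm_inverse divide_inverse)
  have "inv_el (paravec s) = (1 / (norm s)\<^sup>2) *\<^sub>R paravec (u, - (norm x *\<^sub>R J))"
    using paravec_inverse(3) [of u x] assms x by (simp add: s)
  moreover have "(norm s)\<^sup>2 = u\<^sup>2 + (norm x)\<^sup>2"
    by (simp add: s norm_Pair)
  ultimately have R: "cnum (inv_el (paravec s)) = Re z *\<^sub>R 1 + Im z *\<^sub>R E"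
    by (simp add: cnum_scaleR cnum_paravec imvec_simps cnum_uminus z_def E_def scaleR_diff_right)
  have "norm (cnum (inv_el (paravec s)) ^ m :: ('v, 'n) clop)
      \<le> (norm (1 :: ('v, 'n) clop) + norm E) * (1 / norm s) ^ m" for m
  proof -
    have "norm (cnum (inv_el (paravec s)) ^ m :: ('v, 'n) clop)
        \<le> \<bar>Re (z ^ m)\<bar> * norm (1 :: ('v, 'n) clop) + \<bar>Im (z ^ m)\<bar> * norm E"
      using J unfolding R E_def
      by (subst imaginary_unit_power) (auto simp: cnum_imvec_sphere intro!: norm_triangle_le)
    also have "\<dots> \<le> cmod (z ^ m) * norm (1 :: ('v, 'n) clop) + cmod (z ^ m) * norm E"
      by (intro add_mono mult_right_mono abs_Re_le_cmod abs_Im_le_cmod norm_ge_zero)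
    finally show ?thesis by (simp add: norm_power z algebra_simps)
  qed
  then show ?thesis by (rule that)
qed

lemma norm_power_clop_le:
  fixes F :: "('v::real_normed_vector, 'n::{finite,linorder}) clop"
  shows "norm (F ^ m) \<le> norm F ^ m"
proof (cases m)
  case (Suc k)
  then show ?thesis by (simp only: norm_power_Suc_le)
qed (simp add: norm_one_clop_le)

lemma norm_inv_power_conv_le:
  assumes "T \<in> BC01"
  shows "norm (inv_power_conv l l T (cconj T) m)
    \<le> (\<Sum>j\<le>m. inv_power_coeff l j * inv_power_coeff l (m - j)) * norm T ^ m"
  unfolding inv_power_conv_def sum_distrib_right
proof (rule sum_norm_le)
  fix j assume "j \<in> {..m}"
  have "norm (T ^ (m - j) * cconj T ^ j) \<le> norm (T ^ (m - j)) * norm (cconj T ^ j)"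
    by (rule norm_mult_ineq)
  also have "\<dots> \<le> norm T ^ (m - j) * norm T ^ j"
    using norm_power_clop_le [of "cconj T" j]
    by (intro mult_mono norm_power_clop_le) (simp_all add: norm_cconj [OF assms])
  also have "\<dots> = norm T ^ m"
    using \<open>j \<in> {..m}\<close> by (simp flip: power_add)
  finally have "inv_power_coeff l j * inv_power_coeff l (m - j) * norm (T ^ (m - j) * cconj T ^ j)
      \<le> inv_power_coeff l j * inv_power_coeff l (m - j) * norm T ^ m"
    by (intro mult_left_mono) (simp_all add: inv_power_coeff_nonneg)
  then show "norm ((inv_power_coeff l (m - j) * inv_power_coeff l j) *\<^sub>R (T ^ (m - j) * cconj T ^ j))
      \<le> inv_power_coeff l j * inv_power_coeff l (m - j) * norm T ^ m"
    by (simp add: inv_power_coeff_nonneg mult.commute)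
qed

lemma summable_Hpoly_series:
  fixes T :: "('v::banach, 'n::{finite,linorder}) clop"
  assumes T: "T \<in> BC01" and s: "norm T < norm s"
  shows "summable (\<lambda>m. inv_power_conv l l T (cconj T) m * cnum (inv_el (paravec s)) ^ (m + 2 * l))"
proof -
  have pos: "norm s > 0" using s norm_ge_zero [of T] by linarith
  then have "s \<noteq> 0" by simp
  then obtain C where C: "\<And>m. norm (cnum (inv_el (paravec s)) ^ m :: ('v, 'n) clop)
      \<le> C * (1 / norm s) ^ m"
    by (rule norm_power_inv_paravec [where 'v = 'v]) blast
  define q where "q = norm T / norm s"
  have q: "0 \<le> q" "q < 1" using s pos by (simp_all add: q_def)
  \<comment> \<open>The dominating series is, up to a constant, the Cauchy square of the scalar
    series of \<open>(1 - q) ^ (- l)\<close>, which converges because \<open>q < 1\<close>.\<close>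
  define w where "w m = (\<Sum>j\<le>m. (inv_power_coeff l j * q ^ j) * (inv_power_coeff l (m - j) * q ^ (m - j)))" for m
  have "summable w"
    unfolding w_def
    by (rule summable_Cauchy_product)
       (use summable_inv_power_coeff [OF q, of l] q in \<open>simp_all add: abs_mult inv_power_coeff_nonneg\<close>)
  then have "summable (\<lambda>m. w m * (C * (1 / norm s) ^ (2 * l)))"
    by (rule summable_mult2)
  then show ?thesis
  proof (rule summable_comparison_test' [where N = 0])
    fix m
    let ?c = "\<Sum>j\<le>m. inv_power_coeff l j * inv_power_coeff l (m - j)"
    have w: "w m = ?c * q ^ m"
      unfolding w_def sum_distrib_right
      by (rule sum.cong) (simp_all add: mult_ac flip: power_add)
    have "norm (inv_power_conv l l T (cconj T) m * cnum (inv_el (paravec s)) ^ (m + 2 * l))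
        \<le> norm (inv_power_conv l l T (cconj T) m) * norm (cnum (inv_el (paravec s)) ^ (m + 2 * l) :: ('v, 'n) clop)"
      by (rule norm_mult_ineq)
    also have "\<dots> \<le> (?c * norm T ^ m) * (C * (1 / norm s) ^ (m + 2 * l))"
      by (intro mult_mono norm_inv_power_conv_le T C mult_nonneg_nonneg sum_nonneg)
         (simp_all add: inv_power_coeff_nonneg)
    also have "\<dots> = w m * (C * (1 / norm s) ^ (2 * l))"
      unfolding w by (simp add: q_def power_add power_divide)
    finally show "norm (inv_power_conv l l T (cconj T) m * cnum (inv_el (paravec s)) ^ (m + 2 * l))
        \<le> w m * (C * (1 / norm s) ^ (2 * l))" .
  qed
qed

section \<open>Two-sided linear coefficients and multiplication by \<open>Qc s T\<close>\<close>

lemma two_sided_linear_inv_power_conv: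
  assumes T: "T \<in> BC01"
  shows "two_sided_linear (inv_power_conv l l T (cconj T) m)"
proof (induction l arbitrary: m)
  case 0
  show ?case by (simp add: inv_power_conv_00 two_sided_linear_intros)
next
  case (Suc l)
  show ?case
  \<comment> \<open>The three-term recursion involves only \<open>T + cconj T\<close> and
    \<open>T * cconj T\<close>, which are two-sided linear although \<open>T\<close> itself need not
    be.\<close>
  proof (induction m rule: induct_nat_012)
    case 0
    show ?case by (simp add: two_sided_linear_one)
  next
    case 1
    show ?case
      using inv_power_conv_1 [OF T_cconj_commute [OF T], of l] Suc.IH [of 1]
      by (simp add: T_plus_cconj [OF T] two_sided_linear_intros two_sided_linear_cemb)
  next
    case (ge2 m)
    then show ?case
      using Suc.IH two_sided_linear_T_cconj [OF T]
      by (simp add: inv_power_conv_Suc_Suc [OF T_cconj_commute [OF T]] T_plus_cconj [OF T]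
          two_sided_linear_intros two_sided_linear_cemb)
  qed
qed

lemma Qc_eq: "Qc s T = cnum (paravec s) * cnum (paravec s)
    - cnum (paravec s) * (2 *\<^sub>R cemb (scalar_part T)) + T * cconj T"
  by (simp add: Qc_def power2_eq_square cnum_mult)

lemma commute_closed:
  fixes x :: "'a::ring"
  assumes "x * a = a * x" "x * b = b * x"
  shows commute_mult: "x * (a * b) = a * b * x"
    and commute_add: "x * (a + b) = (a + b) * x"
    and commute_diff: "x * (a - b) = (a - b) * x"
  by (simp_all add: assms algebra_simps) (metis assms mult.assoc)

lemma Qc_mult_series:
  fixes T :: "('v::banach, 'n::{finite,linorder}) clop"
  assumes T: "T \<in> BC01" and s: "norm T < norm s"
  defines "f \<equiv> \<lambda>l m. inv_power_conv l l T (cconj T) m * cnum (inv_el (paravec s)) ^ (m + 2 * l)"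
  shows "Qc s T * suminf (f (Suc l)) = suminf (f l)"
    and "suminf (f l) * Qc s T = Qc s T * suminf (f l)"
proof -
  define c :: "('v, 'n) clop" where "c = cnum (paravec s)"
  define R :: "('v, 'n) clop" where "R = cnum (inv_el (paravec s))"
  define t :: "('v, 'n) clop" where "t = 2 *\<^sub>R cemb (scalar_part T)"
  define D where "D = T * cconj T"
  define p where "p l m = inv_power_conv l l T (cconj T) m" for l m
  have Q: "Qc s T = c * c - c * t + D"
    by (simp add: Qc_eq c_def t_def D_def)
  have "s \<noteq> 0" using s norm_ge_zero [of T] by auto
  then have cR: "c * R = 1" and Rc: "R * c = 1"
    using paravec_inverse [of "fst s" "snd s"] by (simp_all add: c_def R_def cnum_one flip: cnum_mult)
  have lin_t: "two_sided_linear t" and lin_D: "two_sided_linear D"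
    using two_sided_linear_T_cconj [OF T]
    by (simp_all add: t_def D_def two_sided_linear_intros two_sided_linear_cemb)
  have lin_p: "two_sided_linear (p l m)" for l m
    unfolding p_def by (rule two_sided_linear_inv_power_conv [OF T])
  have tc: "t * c = c * t" and tR: "t * R = R * t" and DR: "D * R = R * D"
    and pc: "p l m * c = c * p l m" for l m
    unfolding c_def R_def by (simp_all add: two_sided_linearD lin_t lin_D lin_p)
  have TT: "T * cconj T = cconj T * T" by (rule T_cconj_commute [OF T])
  have f: "f l m = p l m * R ^ (m + 2 * l)" for l m
    by (simp add: f_def p_def R_def)
  have sums: "f l sums suminf (f l)" for l
    using summable_Hpoly_series [OF T s, of l] unfolding f_def by (rule summable_sums)

  \<comment> \<open>Each term of the series commutes with the three summands of
    \<open>Qc s T\<close>, and continuity of the product carries this over to the sum.\<close>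
  have pt: "p l m * t = t * p l m" for l m
    unfolding p_def t_def
    using inv_power_conv_commute [OF T_scalar_part_commute [OF T] cconj_scalar_part_commute [OF T]]
    by simp
  have TD: "T * D = D * T"
    unfolding D_def by (metis TT mult.assoc)
  have T'D: "cconj T * D = D * cconj T"
    unfolding D_def by (metis TT mult.assoc)
  have pD: "p l m * D = D * p l m" for l m
    unfolding p_def by (rule inv_power_conv_commute [OF TD T'D])
  have pQ: "p l m * Qc s T = Qc s T * p l m" for l m
    unfolding Q by (intro commute_closed pc pt pD)
  have RQ: "R * Qc s T = Qc s T * R"
    unfolding Q by (intro commute_closed DR [symmetric] tR [symmetric]) (simp_all add: cR Rc)
  have "f l m * Qc s T = Qc s T * f l m" for l m
    unfolding f by (rule commute_mult [symmetric, OF pQ [symmetric] power_commute [OF RQ, symmetric]])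
  then have "f l sums suminf (f l) \<Longrightarrow> (\<lambda>m. Qc s T * f l m) sums (suminf (f l) * Qc s T)" for l
    using sums_mult2 [of "f l" "suminf (f l)" "Qc s T"] by simp
  then show "suminf (f l) * Qc s T = Qc s T * suminf (f l)"
    using sums_mult [OF sums [of l], of "Qc s T"] sums [of l] sums_unique2 by blast

  \<comment> \<open>The term \<open>f (Suc l) m\<close> carries \<open>R ^ (m + 2 * l + 2)\<close>.
    The factor \<open>c * c\<close> cancels two powers of \<open>R\<close>, \<open>c * t\<close>
    cancels one and \<open>D\<close> none, so the latter two products are shifted by one and two
    places, padded with zeros, to align equal powers of \<open>R\<close>.\<close>
  define F where "F m = c * c * f (Suc l) m" for m
  define G where "G m = c * t * f (Suc l) m" for m
  define H where "H m = D * f (Suc l) m" for m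
  define G' where "G' m = (case m of 0 \<Rightarrow> 0 | Suc k \<Rightarrow> G k)" for m
  define H' where "H' m = (case m of Suc (Suc k) \<Rightarrow> H k | _ \<Rightarrow> 0)" for m
  let ?S = "suminf (f (Suc l))"
  have "G sums (c * t * ?S)" "H sums (D * ?S)" and Fs: "F sums (c * c * ?S)"
    unfolding F_def G_def H_def by (intro sums_mult sums)+
  then have Gs: "G' sums (c * t * ?S)" and Hs: "H' sums (D * ?S)"
    using sums_Suc_iff [of G' "c * t * ?S"] sums_Suc_iff [of H' "D * ?S"]
      sums_Suc_iff [of "\<lambda>m. H' (Suc m)" "D * ?S"]
    by (simp_all add: G'_def H'_def)
  have cR_Suc: "c * R ^ Suc k = R ^ k" for k
    by (simp add: cR flip: mult.assoc)
  have Fm: "F m = p (Suc l) m * R ^ (m + 2 * l)" for m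
  proof -
    have "F m = p (Suc l) m * (c * (c * R ^ Suc (Suc (m + 2 * l))))"
      unfolding F_def f by (simp add: mult.assoc [symmetric] pc) (simp add: mult.assoc pc)
    then show ?thesis by (simp only: cR_Suc)
  qed
  have Gm: "G m = t * p (Suc l) m * R ^ (Suc m + 2 * l)" for m
  proof -
    have "G m = t * p (Suc l) m * (c * R ^ Suc (Suc m + 2 * l))"
      unfolding G_def f tc [symmetric] by (simp add: mult.assoc) (metis pc mult.assoc)
    then show ?thesis by (simp only: cR_Suc)
  qed
  have Hm: "H m = D * p (Suc l) m * R ^ (Suc (Suc m) + 2 * l)" for m
    by (simp add: H_def f mult.assoc)
  have "F m - G' m + H' m = f l m" for m
  proof -
    \<comment> \<open>The padding makes \<open>m = 0\<close> and \<open>m = 1\<close> boundary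
      cases: the first compares leading coefficients \<open>1\<close>, the second uses the recursion
      without its product term.\<close>
    consider "m = 0" | "m = 1" | k where "m = Suc (Suc k)"
      by (metis One_nat_def not0_implies_Suc)
    then show ?thesis
    proof cases
      case 1
      then show ?thesis by (simp add: G'_def H'_def Fm f p_def)
    next
      case 2
      have "p (Suc l) 1 - t = p l 1"
        unfolding p_def t_def using inv_power_conv_1 [OF TT, of l] by (simp add: T_plus_cconj [OF T])
      then show ?thesis
        using 2 by (simp add: G'_def H'_def Fm Gm f p_def flip: left_diff_distrib)
    next
      case 3
      have "p (Suc l) m - t * p (Suc l) (Suc k) + D * p (Suc l) k = p l m"
        unfolding p_def t_def D_def 3 inv_power_conv_Suc_Suc [OF TT]
        by (simp add: T_plus_cconj [OF T])
      then show ?thesis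
        using 3 by (simp add: G'_def H'_def Fm Gm Hm f flip: left_diff_distrib distrib_right)
    qed
  qed
  then have "f l sums (c * c * ?S - c * t * ?S + D * ?S)"
    using sums_add [OF sums_diff [OF Fs Gs] Hs] by simp
  then have "f l sums (Qc s T * ?S)"
    by (simp add: Q left_diff_distrib distrib_right)
  then show "Qc s T * ?S = suminf (f l)"
    by (rule sums_unique)
qed

lemma Qc_power_sums:
  fixes T :: "('v::banach, 'n::{finite,linorder}) clop"
  assumes T: "T \<in> BC01" and s: "norm T < norm s"
  shows "s \<in> rho_S T"
    and "(\<lambda>m. inv_power_conv l l T (cconj T) m * cnum (inv_el (paravec s)) ^ (m + 2 * l))
      sums (inv_el (Qc s T) ^ l)"
proof -
  define f where
    "f = (\<lambda>l m. inv_power_conv l l T (cconj T) m * cnum (inv_el (paravec s)) ^ (m + 2 * l))"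
  have rec: "Qc s T * suminf (f (Suc l)) = suminf (f l)"
    "suminf (f l) * Qc s T = Qc s T * suminf (f l)" for l
    unfolding f_def by (rule Qc_mult_series [OF T s])+
  have "f 0 = (\<lambda>m. if m = 0 then 1 else 0)"
    by (auto simp: f_def inv_power_conv_00)
  then have f0: "suminf (f 0) = 1"
    using sums_single [of 0 "\<lambda>_. 1 :: ('v, 'n) clop"] by (simp add: sums_iff)
  \<comment> \<open>The step from \<open>l = 0\<close> to \<open>l = 1\<close> exhibits the series
    as a right inverse; as it commutes with \<open>Qc s T\<close>, it is two-sided.\<close>
  have inv: "has_inv (Qc s T)"
    by (rule has_invI [of _ "suminf (f 1)"]) (use rec(1) [of 0] rec(2) [of 1] f0 in simp_all)
  then show "s \<in> rho_S T" by (simp add: rho_S_def)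
  have "suminf (f l) = inv_el (Qc s T) ^ l"
  proof (induction l)
    case (Suc l)
    have "suminf (f (Suc l)) = inv_el (Qc s T) * (Qc s T * suminf (f (Suc l)))"
      by (simp add: inv_el_right_left(2) [OF inv] flip: mult.assoc)
    then show ?case by (simp add: rec(1) Suc.IH)
  qed (simp add: f0)
  moreover have "f l sums suminf (f l)"
    using summable_Hpoly_series [OF T s, of l] unfolding f_def by (rule summable_sums)
  ultimately show "(\<lambda>m. inv_power_conv l l T (cconj T) m * cnum (inv_el (paravec s)) ^ (m + 2 * l))
      sums (inv_el (Qc s T) ^ l)"
    by (simp add: f_def)
qed

section \<open>Slice structure of the resolvent\<close>

text \<open>\<open>Q_re\<close> and \<open>Q_im\<close> are the formal real and imaginary parts of
  \<open>z^2 - 2 z T_0 + T * cconj T\<close> at \<open>z = u + i v\<close>.\<close>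

definition Q_re :: "('v::real_normed_vector, 'n::{finite,linorder}) clop \<Rightarrow> real \<Rightarrow> real \<Rightarrow> ('v, 'n) clop" where
  "Q_re T u v = (u\<^sup>2 - v\<^sup>2) *\<^sub>R 1 - u *\<^sub>R (2 *\<^sub>R cemb (scalar_part T)) + T * cconj T"

definition Q_im :: "('v::real_normed_vector, 'n::{finite,linorder}) clop \<Rightarrow> real \<Rightarrow> real \<Rightarrow> ('v, 'n) clop" where
  "Q_im T u v = (2 * u * v) *\<^sub>R 1 - v *\<^sub>R (2 *\<^sub>R cemb (scalar_part T))"

lemma Qc_slice:
  fixes T :: "('v::real_normed_vector, 'n::{finite,linorder}) clop"
  assumes "J \<in> sphere 0 1"
  shows "Qc (u, v *\<^sub>R J) T = Q_re T u v + cnum (imvec J) * Q_im T u v"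
proof -
  have "cnum (paravec (u, v *\<^sub>R J)) = u *\<^sub>R (1 :: ('v, 'n) clop) + v *\<^sub>R cnum (imvec J)"
    by (simp add: cnum_paravec imvec_simps cnum_scaleR)
  then show ?thesis
    using assms
    by (simp add: cnum_imvec_sphere Qc_eq Q_re_def Q_im_def algebra_simps power2_eq_square)
       (simp add: mult_2 scaleR_add_left mult.commute flip: scaleR_add_left)
qed

lemma two_sided_linear_Q:
  assumes "T \<in> BC01"
  shows "two_sided_linear (Q_re T u v)" "two_sided_linear (Q_im T u v)"
  using two_sided_linear_T_cconj [OF assms] unfolding Q_re_def Q_im_def
  by (simp_all add: two_sided_linear_intros two_sided_linear_cemb)

lemma Q_re_im_commute:
  assumes "T \<in> BC01"
  shows "Q_re T u v * Q_im T u v = Q_im T u v * Q_re T u v"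
proof -
  let ?t = "cemb (scalar_part T)"
  have "T * cconj T * ?t = ?t * (T * cconj T)"
    by (metis T_scalar_part_commute [OF assms] cconj_scalar_part_commute [OF assms] mult.assoc)
  then show ?thesis
    unfolding Q_re_def Q_im_def by (simp add: algebra_simps)
qed

text \<open>Conjugation with the vector \<open>J + J'\<close> carries \<open>J\<close> to \<open>J'\<close>.\<close>

lemma has_inv_slice_rotate_aux:
  fixes a b :: "('v::real_normed_vector, 'n::{finite,linorder}) clop"
  assumes lin: "two_sided_linear a" "two_sided_linear b"
    and J: "J \<in> sphere 0 1" and J': "J' \<in> sphere 0 1" and ne: "J' \<noteq> - J"
    and inv: "has_inv (a + cnum (imvec J) * b)"
  shows "has_inv (a + cnum (imvec J') * b)"
proof -
  define q :: "('v, 'n) clop" where "q = cnum (imvec (J + J'))"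
  have "norm (J + J') \<noteq> 0" using ne by (simp add: add_eq_0_iff)
  moreover have "q * q = - ((norm (J + J'))\<^sup>2 *\<^sub>R 1)"
    unfolding q_def by (rule cnum_imvec_square)
  ultimately have q: "q * (- (1 / (norm (J + J'))\<^sup>2) *\<^sub>R q) = 1" "(- (1 / (norm (J + J'))\<^sup>2) *\<^sub>R q) * q = 1"
    by simp_all
  then have hq: "has_inv q" by (rule has_invI)
  have hq': "has_inv (inv_el q)"
    by (rule has_invI [of _ q]) (simp_all add: inv_el_right_left hq)
  \<comment> \<open>Both sides equal \<open>J' J - 1\<close>.\<close>
  have E: "q * cnum (imvec J) = cnum (imvec J') * q"
    using J J' by (simp add: cnum_imvec_sphere q_def imvec_simps cnum_add algebra_simps)
  have ab: "q * a = a * q" "q * b = b * q"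
    unfolding q_def by (simp_all add: two_sided_linearD lin)
  have "q * (a + cnum (imvec J) * b) = (a + cnum (imvec J') * b) * q"
    by (simp add: distrib_left distrib_right ab E mult.assoc flip: mult.assoc) (metis ab E mult.assoc)
  then have "a + cnum (imvec J') * b = q * (a + cnum (imvec J) * b) * inv_el q"
    using inv_el_right_left(1) [OF hq] by (simp add: mult.assoc)
  then show ?thesis
    by (simp only: has_inv_mult hq hq' inv)
qed

text \<open>Two distinct coordinate axes cannot both lie on the line through
  \<open>J\<close>.\<close>

lemma exists_third_direction:
  fixes J :: "real ^ 'n"
  assumes "2 \<le> CARD('n)"
  obtains K where "K \<in> sphere 0 1" "K \<noteq> J" "K \<noteq> - J"
proof -
  obtain i j :: 'n where ij: "i \<noteq> j"
    using assms by (metis UNIV_I card_2_iff' card_le_Suc0_iff_eq finite numeral_2_eq_2 not_less_eq_eq)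
  have "axis i (1::real) \<noteq> axis j 1" "axis i (1::real) \<noteq> - axis j 1"
    using ij by (auto simp: axis_def vec_eq_iff)
  then have "axis i 1 \<noteq> J \<and> axis i 1 \<noteq> - J \<or> axis j 1 \<noteq> J \<and> axis j 1 \<noteq> - J"
    by (metis minus_minus)
  then show ?thesis
    using that [of "axis i 1"] that [of "axis j 1"] by (auto simp: norm_axis_1)
qed

lemma has_inv_slice_rotate:
  fixes J :: "real ^ 'n::{finite,linorder}"
  assumes "two_sided_linear a" "two_sided_linear b"
    and "J \<in> sphere 0 1" and "J' \<in> sphere 0 1" and "2 \<le> CARD('n)"
    and "has_inv (a + cnum (imvec J) * b)"
  shows "has_inv (a + cnum (imvec J') * b)"
proof (cases "J' = - J")
  \<comment> \<open>For antipodal directions \<open>J + J'\<close> vanishes, so the rotation goes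
    through a third direction \<open>K\<close>.\<close>
  case True
  obtain K where K: "K \<in> sphere 0 1" "K \<noteq> J" "K \<noteq> - J"
    using exists_third_direction [OF assms(5)] by blast
  then have "has_inv (a + cnum (imvec K) * b)"
    using assms by (intro has_inv_slice_rotate_aux [of a b J K])
  then show ?thesis
    using K True assms by (intro has_inv_slice_rotate_aux [of a b K J']) (auto simp: minus_equation_iff)
qed (use assms has_inv_slice_rotate_aux in blast)

lemma axially_symmetric_rho_S:
  fixes T :: "('v::real_normed_vector, 'n::{finite,linorder}) clop"
  assumes T: "T \<in> BC01" and "2 \<le> CARD('n)"
  shows "axially_symmetric (rho_S T)"
  unfolding axially_symmetric_def
proof (clarify)
  fix u x and J' :: "real ^ 'n::{finite,linorder}"
  assume inv: "(u, x) \<in> rho_S T" and J': "J' \<in> sphere 0 1"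
  obtain J where J: "J \<in> sphere 0 1" and x: "x = norm x *\<^sub>R J" by (rule obtain_direction)
  have "has_inv (Qc (u, norm x *\<^sub>R J) T)"
    using inv x by (simp add: rho_S_def)
  then have "has_inv (Qc (u, norm x *\<^sub>R J') T)"
    unfolding Qc_slice [OF J] Qc_slice [OF J']
    by (intro has_inv_slice_rotate [OF two_sided_linear_Q [OF T] J J' assms(2)])
  then show "(u, norm x *\<^sub>R J') \<in> rho_S T" by (simp add: rho_S_def)
qed

lemma open_rho_S:
  fixes T :: "('v::banach, 'n::{finite,linorder}) clop"
  shows "open (rho_S T)"
proof -
  have "continuous_on UNIV (\<lambda>s. cnum (paravec s) :: ('v, 'n) clop)"
    unfolding paravec_def cnum_add cnum_of_real cnum_imvec
    by (intro continuous_intros)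
  then have "continuous_on UNIV (\<lambda>s. Qc s T)"
    unfolding Qc_eq by (intro continuous_intros)
  then have "open ((\<lambda>s. Qc s T) -` {F. has_inv F})"
    by (rule open_vimage [OF open_has_inv])
  then show ?thesis by (simp add: rho_S_def vimage_def)
qed

lemma slice_domD: "(u, v) \<in> slice_dom U \<Longrightarrow> J \<in> sphere 0 1 \<Longrightarrow> (u, v *\<^sub>R J) \<in> U"
  by (simp add: slice_dom_def)

text \<open>Elements \<open>X + J Y\<close> with two-sided linear \<open>X, Y\<close> multiply like complex numbers, by the same
  rule for every \<open>J\<close>.\<close>

lemma resolvent_power_components:
  fixes T :: "('v::real_normed_vector, 'n::{finite,linorder}) clop"
  assumes T: "T \<in> BC01" and dom: "(u, v) \<in> slice_dom (rho_S T)"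
  shows "\<exists>X Y. two_sided_linear X \<and> two_sided_linear Y \<and>
    (\<forall>J\<in>sphere 0 1. inv_el (Qc (u, v *\<^sub>R J) T) ^ l = X + cnum (imvec J) * Y)"
proof -
  let ?a = "Q_re T u v" and ?b = "Q_im T u v" and ?E = "\<lambda>J :: real ^ 'n::{finite,linorder}. cnum (imvec J) :: ('v, 'n) clop"
  note lin = two_sided_linear_Q [OF T, of u v]
  have EE: "?E J * (?E J * F) = - F" if "J \<in> sphere 0 1" for J F
    using that by (simp add: cnum_imvec_sphere flip: mult.assoc)
  have Q: "has_inv (?a + ?E J * ?b)" if "J \<in> sphere 0 1" for J
    using slice_domD [OF dom that] by (simp add: rho_S_def Qc_slice [OF that])
  have prod: "(?a + ?E J * ?b) * (?a - ?E J * ?b) = ?a * ?a + ?b * ?b" if J: "J \<in> sphere 0 1" for J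
    using lin EE [OF J] by (simp add: algebra_simps two_sided_linear_left_commute Q_re_im_commute [OF T])
  define N where "N = ?a * ?a + ?b * ?b"
  define X where "X = ?a * inv_el N"
  define Y where "Y = - (?b * inv_el N)"
  have N: "has_inv N"
  proof -
    obtain J :: "real ^ 'n::{finite,linorder}" where J: "J \<in> sphere 0 1"
      by (metis obtain_direction)
    \<comment> \<open>The slice domain contains the whole sphere of directions, so invertibility is
      available at \<open>- J\<close> as well.\<close>
    then have "has_inv (?a - ?E J * ?b)"
      using Q [of "- J"] by (simp add: imvec_simps cnum_uminus)
    then show ?thesis
      unfolding N_def prod [OF J, symmetric] by (intro has_inv_mult Q J)
  qed
  have linXY: "two_sided_linear X" "two_sided_linear Y"
    unfolding X_def Y_def N_def
    by (intro two_sided_linear_intros two_sided_linear_inv_el N [unfolded N_def] lin)+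
  have XY: "inv_el (Qc (u, v *\<^sub>R J) T) = X + ?E J * Y" if J: "J \<in> sphere 0 1" for J
    unfolding Qc_slice [OF J]
  proof (rule inv_el_eq_right_inverse [OF Q [OF J]])
    have "X + ?E J * Y = (?a - ?E J * ?b) * inv_el N"
      by (simp add: X_def Y_def left_diff_distrib mult.assoc)
    then show "(?a + ?E J * ?b) * (X + ?E J * Y) = 1"
      using prod [OF J] inv_el_right_left(1) [OF N] by (simp add: N_def flip: mult.assoc)
  qed
  show ?thesis
  proof (induction l)
    case 0
    show ?case
      by (rule exI [of _ 1], rule exI [of _ 0]) (simp add: two_sided_linear_one two_sided_linear_zero)
  next
    case (Suc l)
    then obtain X' Y' where lin': "two_sided_linear X'" "two_sided_linear Y'"
      and XY': "\<And>J. J \<in> sphere 0 1 \<Longrightarrow> inv_el (Qc (u, v *\<^sub>R J) T) ^ l = X' + ?E J * Y'"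
      by blast
    have "inv_el (Qc (u, v *\<^sub>R J) T) ^ Suc l = (X * X' - Y * Y') + ?E J * (X * Y' + Y * X')"
      if J: "J \<in> sphere 0 1" for J
      unfolding power_Suc XY' [OF J] unfolding XY [OF J]
      using linXY EE [OF J] by (simp add: algebra_simps two_sided_linear_left_commute)
    moreover have "two_sided_linear (X * X' - Y * Y')" "two_sided_linear (X * Y' + Y * X')"
      by (intro two_sided_linear_intros linXY lin')+
    ultimately show ?case by blast
  qed
qed

section \<open>Cauchy-Riemann equations and the intrinsic slice form\<close>

lemma resolvent_power_derivatives:
  fixes T :: "('v::banach, 'n::{finite,linorder}) clop"
  assumes T: "T \<in> BC01" and J: "J \<in> sphere 0 1" and inv: "(u, v *\<^sub>R J) \<in> rho_S T"
  shows "\<exists>P. ((\<lambda>x. inv_el (Qc (x, v *\<^sub>R J) T) ^ l) has_vector_derivative P) (at u) \<and>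
    ((\<lambda>y. inv_el (Qc (u, y *\<^sub>R J) T) ^ l) has_vector_derivative cnum (imvec J) * P) (at v)"
proof -
  define E :: "('v, 'n) clop" where "E = cnum (imvec J)"
  have EE: "E * E = - 1" "E * (E * F) = - F" for F
    using J by (simp_all add: E_def cnum_imvec_sphere flip: mult.assoc)
  have Qc: "Qc (x, y *\<^sub>R J) T = Q_re T x y + E * Q_im T x y" for x y
    unfolding E_def by (rule Qc_slice [OF J])
  let ?G = "inv_el (Qc (u, v *\<^sub>R J) T)"
  \<comment> \<open>This is \<open>2 (s - T_0)\<close> at \<open>s = u + v J\<close>, the derivative
    of \<open>Qc\<close> in \<open>u\<close>; the derivative in \<open>v\<close> is \<open>E\<close>
    times it.\<close>
  let ?D = "2 *\<^sub>R (u *\<^sub>R 1 - cemb (scalar_part T)) + E * (2 * v) *\<^sub>R 1"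
  have hinv: "has_inv (Qc (u, v *\<^sub>R J) T)" using inv by (simp add: rho_S_def)
  have "E * Qc (u, v *\<^sub>R J) T = Qc (u, v *\<^sub>R J) T * E"
    unfolding Qc E_def
    by (intro commute_add commute_mult refl two_sided_linear_Q [OF T, THEN two_sided_linearD])
  \<comment> \<open>Commuting with the inverse, \<open>E\<close> can be pulled to the front of every
    derivative in \<open>v\<close>.\<close>
  then have EG: "?G * E = E * ?G"
    by (intro inv_el_commute hinv) simp
  have "((\<lambda>x. Qc (x, v *\<^sub>R J) T) has_vector_derivative ?D) (at u)"
    unfolding Qc Q_re_def Q_im_def
    by (rule derivative_eq_intros refl | simp add: algebra_simps)+
  then have u: "((\<lambda>x. inv_el (Qc (x, v *\<^sub>R J) T)) has_vector_derivative - (?G * ?D * ?G)) (at u)"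
    by (rule has_vector_derivative_inv_el) (rule hinv)
  have "((\<lambda>y. Qc (u, y *\<^sub>R J) T) has_vector_derivative E * ?D) (at v)"
    unfolding Qc Q_re_def Q_im_def
    by (rule derivative_eq_intros refl | simp add: algebra_simps EE)+
  then have "((\<lambda>y. inv_el (Qc (u, y *\<^sub>R J) T)) has_vector_derivative - (?G * (E * ?D) * ?G)) (at v)"
    by (rule has_vector_derivative_inv_el) (rule hinv)
  moreover have "- (?G * (E * ?D) * ?G) = E * - (?G * ?D * ?G)"
    by (simp only: mult_minus_right mult.assoc [symmetric] EG)
  ultimately have v: "((\<lambda>y. inv_el (Qc (u, y *\<^sub>R J) T)) has_vector_derivative E * - (?G * ?D * ?G)) (at v)"
    by simp
  show ?thesis unfolding E_def [symmetric]
  proof (induction l)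
    case 0
    show ?case by (intro exI [of _ 0]) simp
  next
    case (Suc l)
    then obtain P where P: "((\<lambda>x. inv_el (Qc (x, v *\<^sub>R J) T) ^ l) has_vector_derivative P) (at u)"
      and P': "((\<lambda>y. inv_el (Qc (u, y *\<^sub>R J) T) ^ l) has_vector_derivative E * P) (at v)"
      by blast
    have "?G * (E * P) + E * - (?G * ?D * ?G) * ?G ^ l = E * (?G * P + - (?G * ?D * ?G) * ?G ^ l)"
      by (simp only: distrib_left mult.assoc [symmetric] EG)
    then have "((\<lambda>y. inv_el (Qc (u, y *\<^sub>R J) T) ^ Suc l)
        has_vector_derivative E * (?G * P + - (?G * ?D * ?G) * ?G ^ l)) (at v)"
      using has_vector_derivative_mult [OF v P'] by (simp only: power_Suc)
    moreover have "((\<lambda>x. inv_el (Qc (x, v *\<^sub>R J) T) ^ Suc l)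
        has_vector_derivative ?G * P + - (?G * ?D * ?G) * ?G ^ l) (at u)"
      using has_vector_derivative_mult [OF u P] by (simp only: power_Suc)
    ultimately show ?case by blast
  qed
qed

lemma intrinsic_resolvent_power:
  fixes T :: "('v::banach, 'n::{finite,linorder}) clop"
  assumes T: "T \<in> BC01" and card: "2 \<le> CARD('n)"
  shows "intrinsic_slice_hyperholomorphic (rho_S T) (\<lambda>s. inv_el (Qc s T) ^ l)"
proof -
  obtain J :: "real ^ 'n::{finite,linorder}" where J: "J \<in> sphere 0 1" by (metis obtain_direction)
  then have J': "- J \<in> sphere 0 1" by simp
  define E :: "('v, 'n) clop" where "E = cnum (imvec J)"
  have EE: "E * E = - 1" "E * (E * F) = - F" for F
    using J by (simp_all add: E_def cnum_imvec_sphere flip: mult.assoc)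
  have E': "cnum (imvec (- J)) = - E"
    by (simp add: E_def imvec_simps cnum_uminus)
  define G where "G K u v = inv_el (Qc (u, v *\<^sub>R K) T) ^ l" for K u v
  \<comment> \<open>The components were obtained only pointwise. Recovering them from the values at
    \<open>J\<close> and \<open>- J\<close> gives formulas that can be differentiated.\<close>
  define A where "A u v = (1 / 2) *\<^sub>R (G J u v + G (- J) u v)" for u v
  define B where "B u v = (1 / 2) *\<^sub>R (- (E * (G J u v - G (- J) u v)))" for u v
  have comp: "two_sided_linear (A u v) \<and> two_sided_linear (B u v) \<and>
      (\<forall>K\<in>sphere 0 1. G K u v = A u v + cnum (imvec K) * B u v)"
    if dom: "(u, v) \<in> slice_dom (rho_S T)" for u v
  proof -
    obtain X Y where lin: "two_sided_linear X" "two_sided_linear Y"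
      and XY: "\<And>K. K \<in> sphere 0 1 \<Longrightarrow> G K u v = X + cnum (imvec K) * Y"
      unfolding G_def using resolvent_power_components [OF T dom, of l] by blast
    have "G J u v = X + E * Y" "G (- J) u v = X - E * Y"
      using XY [OF J] XY [OF J'] by (simp_all add: E' E_def [symmetric])
    then have "A u v = X" "B u v = Y"
      by (simp_all add: A_def B_def EE distrib_left flip: scaleR_2)
    then show ?thesis using lin XY by simp
  qed
  have parity: "A u (- v) = A u v" "B u (- v) = - B u v" for u v
  proof -
    \<comment> \<open>The points \<open>(u, (- v) J)\<close> and \<open>(u, v (- J))\<close>
      coincide, so a sign change of \<open>v\<close> swaps the two values.\<close>
    have "G J u (- v) = G (- J) u v" "G (- J) u (- v) = G J u v"
      by (simp_all add: G_def)
    then show "A u (- v) = A u v" "B u (- v) = - B u v"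
      by (simp_all add: A_def B_def algebra_simps)
  qed
  have deriv: "\<exists>P Q. ((\<lambda>x. A x v) has_vector_derivative P) (at u) \<and>
      ((\<lambda>y. B u y) has_vector_derivative P) (at v) \<and>
      ((\<lambda>y. A u y) has_vector_derivative Q) (at v) \<and>
      ((\<lambda>x. B x v) has_vector_derivative (- Q)) (at u)"
    if dom: "(u, v) \<in> slice_dom (rho_S T)" for u v
  proof -
    obtain P1 where P1: "((\<lambda>x. G J x v) has_vector_derivative P1) (at u)"
      "((\<lambda>y. G J u y) has_vector_derivative E * P1) (at v)"
      using resolvent_power_derivatives [OF T J slice_domD [OF dom J], of l]
      unfolding G_def E_def by blast
    obtain P2 where P2: "((\<lambda>x. G (- J) x v) has_vector_derivative P2) (at u)"
      "((\<lambda>y. G (- J) u y) has_vector_derivative - E * P2) (at v)"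
      using resolvent_power_derivatives [OF T J' slice_domD [OF dom J'], of l]
      unfolding G_def E' by blast
    \<comment> \<open>On the slices of \<open>J\<close> and \<open>- J\<close>, the derivative in
      \<open>v\<close> is \<open>E\<close> and \<open>- E\<close> times the one in \<open>u\<close>;
      averaging gives \<open>?P\<close> and \<open>?Q\<close>.\<close>
    let ?P = "(1 / 2) *\<^sub>R (P1 + P2)" and ?Q = "(1 / 2) *\<^sub>R (E * (P1 - P2))"
    have "((\<lambda>x. A x v) has_vector_derivative ?P) (at u)"
      unfolding A_def by (rule derivative_eq_intros P1 P2 refl | simp)+
    moreover have "((\<lambda>y. A u y) has_vector_derivative ?Q) (at v)"
      unfolding A_def by (rule derivative_eq_intros P1 P2 refl | simp add: algebra_simps)+
    moreover have "((\<lambda>y. B u y) has_vector_derivative ?P) (at v)"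
      unfolding B_def by (rule derivative_eq_intros P1 P2 refl | simp add: algebra_simps EE)+
    moreover have "((\<lambda>x. B x v) has_vector_derivative - ?Q) (at u)"
      unfolding B_def by (rule derivative_eq_intros P1 P2 refl | simp)+
    ultimately show ?thesis by blast
  qed
  have pair: "slice_pair (rho_S T) A B"
    unfolding slice_pair_def using parity deriv by blast
  \<comment> \<open>This turns the left representation into the right one.\<close>
  have cnum_B: "cnum (imvec K) * B u v = B u v * cnum (imvec K)"
    if "(u, v) \<in> slice_dom (rho_S T)" for u v K
    using comp [OF that] by (simp add: two_sided_linearD)
  show ?thesis
    unfolding intrinsic_slice_hyperholomorphic_def left_slice_rep_def right_slice_rep_def
    using open_rho_S [of T] axially_symmetric_rho_S [OF T card] pair comp
    by (intro exI [of _ A] exI [of _ B]) (auto simp: G_def cnum_B)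
qed

theorem proposition6p15:
  fixes T :: "('v::banach, 'n::{finite,linorder}) clop" and l :: nat
  assumes "odd CARD('n)" and "1 \<le> l" and "l \<le> (CARD('n) - 1) div 2"
    and "T \<in> BC01"
  shows "(\<forall>s :: real \<times> (real ^ 'n::{finite,linorder}). norm T < norm s \<longrightarrow>
           s \<in> rho_S T \<and>
           (\<lambda>i. let k = 2 * l - 1 + i in Hpoly l k T * cnum (inv_el (paravec s) ^ (k + 1)))
             sums (inv_el (Qc s T) ^ l))
    \<and> intrinsic_slice_hyperholomorphic (rho_S T) (\<lambda>s. inv_el (Qc s T) ^ l)"
proof (intro conjI allI impI)
  fix s :: "real \<times> (real ^ 'n::{finite,linorder})"
  assume s: "norm T < norm s"
  show "s \<in> rho_S T" by (rule Qc_power_sums(1) [OF assms(4) s])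
  \<comment> \<open>The exponent \<open>k + 1\<close> at \<open>k = 2 * l - 1 + i\<close>;
    \<open>1 \<le> l\<close> rules out truncation.\<close>
  have "2 * l - 1 + i + 1 = i + 2 * l" for i
    using assms(2) by simp
  then show "(\<lambda>i. let k = 2 * l - 1 + i in Hpoly l k T * cnum (inv_el (paravec s) ^ (k + 1)))
      sums (inv_el (Qc s T) ^ l)"
    unfolding Let_def Hpoly_eq_inv_power_conv [OF assms(2)] cnum_power
    using Qc_power_sums(2) [OF assms(4) s, of l] by (simp add: add.commute)
next
  show "intrinsic_slice_hyperholomorphic (rho_S T) (\<lambda>s. inv_el (Qc s T) ^ l)"
    \<comment> \<open>The bounds on \<open>l\<close> force \<open>CARD('n)\<close> to be at least
      \<open>3\<close>, which supplies the dimension needed for axial symmetry.\<close>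
    using assms by (intro intrinsic_resolvent_power) auto
qed

end
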